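(* Let $a,b\in\mathbb{R}$ with $0<b<a<\pi$, let $k\in\mathbb{N}_0=\{0,1,2,\ldots\}$, and let $\mu,\nu\in\mathbb{C}$ with $\operatorname{Re}(\mu)>2k-\tfrac12$ and $\operatorname{Re}(\nu)>-\tfrac12$. Define $$S_k(a,b)=\sum_{n=0}^{\infty}\varepsilon_n\,\frac{J_\mu(an)}{\left(\frac12 an\right)^{\mu}}\,\frac{J_\nu(bn)}{\left(\frac12 bn\right)^{\nu}}\left(\frac{an}{2}\right)^{2k},$$ where $\varepsilon_0=\tfrac12$ and $\varepsilon_n=1$ for $n\ge1$. Then $$S_k(a,b)=\frac{\Gamma\left(k+\frac12\right)}{a\,\Gamma(\nu+1)\,\Gamma\left(\mu-k+\frac12\right)}\;{}_2F_1\left(\begin{array}{c}\frac12+k,\ \frac12-\mu+k\\ \nu+1\end{array};\left(\frac ba\right)^2\right).$$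
   Context: $J_\nu(z)=\sum_{n=0}^\infty \frac{(-1)^n}{\Gamma(\nu+n+1)\,n!}\left(\frac z2\right)^{\nu+2n}$ is the Bessel function of the first kind. The function $J_\nu(z)\left(\frac z2\right)^{-\nu}$ is entire in $z$, with value $\frac{1}{\Gamma(\nu+1)}$ at $z=0$; the $n=0$ term of the series is understood in this sense (with $0^0=1$ in the factor $(an/2)^{2k}$ when $k=0$). The infinite series is the limit of its partial sums (it need not converge absolutely). ${}_2F_1\left(\begin{array}{c}\alpha,\beta\\ \gamma\end{array};z\right)=\sum_{j=0}^\infty\frac{(\alpha)_j(\beta)_j}{(\gamma)_j}\frac{z^j}{j!}$ for $|z|<1$ is Gauss' hypergeometric function, where $(u)_j=u(u+1)\cdots(u+j-1)$, $(u)_0=1$. *)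

theory Defs
  imports "HOL-Analysis.Analysis"
begin

text \<open>
  Complex powers are principal-branch powers. The library sets \<open>0 powr w = 0\<close> for every \<open>w\<close>,
  so \<open>Bessel_J\<close> is meaningful for \<open>z \<noteq> 0\<close> only. Division by \<open>Gamma\<close> at one of its poles
  gives 0, which is the usual convention for the coefficients.
\<close>
definition Bessel_J :: "complex \<Rightarrow> complex \<Rightarrow> complex" where
  "Bessel_J \<nu> z =
     (\<Sum>n. (-1) ^ n / (Gamma (\<nu> + of_nat n + 1) * fact n) * (z / 2) powr (\<nu> + 2 * of_nat n))"

text \<open>
  The entire function \<open>J\<^sub>\<nu>(z) (z/2)\<^sup>-\<^sup>\<nu>\<close>, with its removable singularity at 0 filled in.
\<close>
definition Bessel_J_quot :: "complex \<Rightarrow> complex \<Rightarrow> complex" where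
  "Bessel_J_quot \<nu> z =
     (if z = 0 then 1 / Gamma (\<nu> + 1) else Bessel_J \<nu> z / (z / 2) powr \<nu>)"

text \<open>Only meaningful for \<open>norm z < 1\<close>.\<close>
definition hypergeo_2F1 :: "complex \<Rightarrow> complex \<Rightarrow> complex \<Rightarrow> complex \<Rightarrow> complex" where
  "hypergeo_2F1 \<alpha> \<beta> \<gamma> z =
     (\<Sum>j. pochhammer \<alpha> j * pochhammer \<beta> j / pochhammer \<gamma> j * (z ^ j / fact j))"

lemma hypergeo_2F1_eq_eval_fps:
  "hypergeo_2F1 \<alpha> \<beta> \<gamma> z = eval_fps (fps_hypergeo [\<alpha>, \<beta>] [\<gamma>] 1) z"
  by (simp add: hypergeo_2F1_def eval_fps_def)

end

theory Submission
  imports Defs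
begin

text \<open>
  Write \<open>q\<^sub>\<nu>(x) = J\<^sub>\<nu>(x) (x/2)\<^sup>-\<^sup>\<nu>\<close>. For \<open>Re \<nu> > -1/2\<close> Poisson's integral says that \<open>q\<^sub>\<nu>(x)\<close> is the value at \<open>cos (x t)\<close> of the
  functional \<open>poisson \<nu>\<close>, integration over \<open>[0, 1]\<close> against a multiple of \<open>(1 - t\<^sup>2)\<^bsup>\<nu> - 1/2\<^esup>\<close>.

  Suppose first that \<open>k = 0\<close>. Then the \<open>q\<^sub>\<mu>(a n)\<close> are, up to a constant, the cosine coefficients on \<open>[0, \<pi>]\<close> of the
  function \<open>g\<close> that equals \<open>(1 - (s/a)\<^sup>2)\<^bsup>\<mu> - 1/2\<^esup>\<close> for \<open>s < a\<close> and \<open>0\<close> for \<open>s > a\<close>. Since \<open>q\<^sub>\<nu>(b n)\<close> is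
  \<open>poisson \<nu>\<close> of \<open>cos (n b t)\<close>, the sum of the theorem is \<open>poisson \<nu>\<close> of the Fourier series of \<open>g\<close> at
  the points \<open>b t\<close>, all of which keep a distance from the singularity of \<open>g\<close> at \<open>a\<close>. If that series converges to
  \<open>g\<close> uniformly on \<open>[0, b]\<close> (\<open>uniform_limit_partial_sum\<close>), the sum is a constant times \<open>poisson \<nu>\<close> of
  \<open>(1 - (b t / a)\<^sup>2)\<^bsup>\<mu> - 1/2\<^esup>\<close>, and expanding this by the binomial theorem and integrating termwise gives
  \<open>\<^sub>2F\<^sub>1\<close> (\<open>Bessel_sum_and_hypergeo_sum_agree_0\<close>).

  The Fourier series need not converge absolutely. Its uniform convergence on \<open>[0, b]\<close> comes from multiplying the partial
  sums by \<open>(cos s - cos a)\<^sup>2\<close>. By the Christoffel--Darboux identity for the cosine kernel the result is a partial sum of the Fourier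
  series of \<open>(cos s - cos a)\<^sup>2 g(s)\<close>, up to boundary terms that vanish in the limit by the Riemann--Lebesgue lemma
  (\<open>smoothed_partial_sum\<close>). The factor removes so much of the singularity that two integrations by parts are possible; the new coefficients
  are \<open>O(1/n\<^sup>2)\<close> (\<open>weight_cos_diff_decay\<close>) and the new series converges uniformly. Its sum is identified by the uniqueness of cosine
  coefficients, and \<open>(cos s - cos a)\<^sup>2\<close> is bounded away from \<open>0\<close> on \<open>[0, b]\<close>.

  For general \<open>k\<close>, the recurrence \<open>(x/2)\<^sup>2 q\<^bsub>\<mu>+2\<^esub> = (\<mu> + 1) q\<^bsub>\<mu>+1\<^esub> - q\<^sub>\<mu>\<close> expresses the sum for \<open>k + 1\<close> by two sums for \<open>k\<close>, and
  a contiguous relation of Gauss says that the right-hand side obeys the same rule.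
\<close>

section \<open>Powers of 1 - t^2 on the unit interval\<close>

text \<open>
  The density of the Poisson integral, with the exponent \<open>m = \<nu> - 1/2\<close>. At \<open>t = 1\<close> it has the
  default value \<open>0\<close> whatever the sign of \<open>Re m\<close>, so that \<open>weight (m + 1) t = weight m t * (1 - t\<^sup>2)\<close>
  holds everywhere and boundary terms at \<open>1\<close> vanish by computation.
\<close>
definition weight :: "complex \<Rightarrow> real \<Rightarrow> complex" where
  "weight m t = of_real (1 - t\<^sup>2) powr m"

lemma norm_weight: "t \<in> {0..1} \<Longrightarrow> norm (weight m t) = (1 - t\<^sup>2) powr Re m"
  unfolding weight_def by (subst norm_powr_real_powr) (auto simp: abs_square_le_1)

lemma weight_plus1: "weight (m + 1) t = weight m t * of_real (1 - t\<^sup>2)"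
  by (cases "of_real (1 - t\<^sup>2) = (0::complex)") (auto simp: weight_def powr_add)

lemma norm_weight_plus1: "t \<in> {0..1} \<Longrightarrow> norm (weight (m + 1) t) = norm (weight m t) * (1 - t\<^sup>2)"
  unfolding weight_plus1 norm_mult norm_of_real by (simp add: abs_square_le_1)

lemma weight_at_1 [simp]: "weight m 1 = 0"
  by (simp add: weight_def)

lemma weight_at_0 [simp]: "weight m 0 = 1"
  by (simp add: weight_def)

lemma has_vector_derivative_weight:
  assumes "\<bar>t\<bar> < 1"
  shows "(weight m has_vector_derivative - (2 * m * of_real t * weight (m - 1) t)) (at t)"
proof -
  have t: "1 - t\<^sup>2 > 0" using assms by (simp add: abs_square_less_1)
  have "((\<lambda>z. (1 - z\<^sup>2) powr m) has_field_derivative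
          (m * (1 - (of_real t)\<^sup>2) powr (m - 1)) * (- 2 * of_real t)) (at (complex_of_real t))"
  proof -
    have *: "1 - (complex_of_real t)\<^sup>2 \<notin> \<real>\<^sub>\<le>\<^sub>0"
    proof -
      have "1 - (complex_of_real t)\<^sup>2 = of_real (1 - t\<^sup>2)" by simp
      then show ?thesis using t by (simp only: complex_nonpos_Reals_iff) simp
    qed
    have "((\<lambda>z. 1 - z\<^sup>2) has_field_derivative (- 2 * of_real t)) (at (complex_of_real t))"
      by (auto intro!: derivative_eq_intros)
    from DERIV_chain2[OF has_field_derivative_powr[OF *] this] show ?thesis .
  qed
  from has_vector_derivative_real_field[OF this]
  show ?thesis by (simp add: weight_def[abs_def] algebra_simps)
qed

lemma continuous_on_weight_Ico: "continuous_on {0..<1} (weight m)"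
  by (rule continuous_at_imp_continuous_on)
     (auto intro!: has_vector_derivative_continuous[OF has_vector_derivative_weight])

lemma continuous_on_weight:
  assumes "Re m > 0"
  shows "continuous_on {0..1} (weight m)"
  unfolding weight_def[abs_def]
  by (intro continuous_on_powr_complex continuous_intros)
     (use assms in \<open>auto simp: abs_square_le_1\<close>)

lemma integrable_one_minus_sq_powr:
  fixes r :: real
  assumes "r > -1"
  shows "(\<lambda>t. (1 - t\<^sup>2) powr r) integrable_on {0..1}"
proof -
  have "((\<lambda>t. (1 - t) powr r) has_integral (- ((1-1) powr (r+1) / (r+1)) - (- ((1-0) powr (r+1) / (r+1))))) {0..1::real}"
  proof (rule fundamental_theorem_of_calculus_interior)
    show "continuous_on {0..1} (\<lambda>t::real. - ((1-t) powr (r+1) / (r+1)))"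
      using assms by (intro continuous_intros continuous_on_powr') auto
    fix t :: real assume "t \<in> {0<..<1}"
    then show "((\<lambda>t. - ((1-t) powr (r+1) / (r+1))) has_vector_derivative (1 - t) powr r) (at t)"
    proof -
      have "((\<lambda>t. (1-t) powr (r+1)) has_real_derivative - ((r+1) * (1-t) powr r)) (at t)"
        using \<open>t \<in> {0<..<1}\<close> by (auto intro!: derivative_eq_intros)
      from DERIV_cdivide[OF DERIV_minus[OF this], of "r+1"] assms show ?thesis
        unfolding has_real_derivative_iff_has_vector_derivative[symmetric] by simp
    qed
  qed simp
  then have "(\<lambda>t::real. (1 - t) powr r) integrable_on {0..1}" by blast
  then have int: "(\<lambda>t::real. 2 powr \<bar>r\<bar> * (1 - t) powr r) integrable_on {0<..<1}"
    by (intro integrable_on_mult_right) (simp add: integrable_on_Icc_iff_Ioo)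
  have "(\<lambda>t. (1 - t\<^sup>2) powr r) absolutely_integrable_on {0<..<1}"
  proof (rule measurable_bounded_by_integrable_imp_absolutely_integrable[OF _ _ int])
    show "(\<lambda>t. (1 - t\<^sup>2) powr r) \<in> borel_measurable (lebesgue_on {0<..<1})"
      by (intro continuous_imp_measurable_on_sets_lebesgue continuous_intros) (auto simp: power2_eq_1_iff)
    fix t :: real assume t: "t \<in> {0<..<1}"
    have "(1 - t\<^sup>2) powr r = (1 + t) powr r * (1 - t) powr r"
      using t by (subst powr_mult[symmetric]) (auto simp: algebra_simps power2_eq_square)
    moreover have "(1 + t) powr r \<le> 2 powr \<bar>r\<bar>"
    proof -
      have "(1 + t) powr r \<le> (1 + t) powr \<bar>r\<bar>" using t by (intro powr_mono) auto
      also have "\<dots> \<le> 2 powr \<bar>r\<bar>" using t by (intro powr_mono2) auto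
      finally show ?thesis .
    qed
    ultimately show "norm ((1 - t\<^sup>2) powr r) \<le> 2 powr \<bar>r\<bar> * (1 - t) powr r"
      by (simp add: mult_right_mono)
  qed simp
  then show ?thesis
    by (simp add: integrable_on_Icc_iff_Ioo set_lebesgue_integral_eq_integral)
qed

text \<open>
  The source of all integrability statements below: every integrand that occurs is smooth inside
  the interval and blows up at \<open>1\<close> no faster than an integrable power of \<open>1 - t\<^sup>2\<close>.
\<close>
lemma absolutely_integrable_dominated_by_weight:
  fixes f :: "real \<Rightarrow> complex"
  assumes "continuous_on {0<..<1} f" "r > -1"
    and "\<And>t. t \<in> {0<..<1} \<Longrightarrow> norm (f t) \<le> K * (1 - t\<^sup>2) powr r"
  shows "f absolutely_integrable_on {0..1}"
  unfolding absolutely_integrable_on_Icc_iff_Ioo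
proof (rule measurable_bounded_by_integrable_imp_absolutely_integrable)
  show "f \<in> borel_measurable (lebesgue_on {0<..<1})"
    using assms by (intro continuous_imp_measurable_on_sets_lebesgue) auto
  show "(\<lambda>t. K * (1 - t\<^sup>2) powr r) integrable_on {0<..<1}"
    using integrable_one_minus_sq_powr[OF \<open>r > -1\<close>]
    by (intro integrable_on_mult_right) (simp add: integrable_on_Icc_iff_Ioo)
qed (use assms in auto)

lemma absolutely_integrable_weight_mult:
  fixes f :: "real \<Rightarrow> complex"
  assumes m: "Re m > -1" and f: "continuous_on {0..1} f"
  shows "(\<lambda>t. weight m t * f t) absolutely_integrable_on {0..1}"
proof -
  obtain K where K: "\<And>t. t \<in> {0..1} \<Longrightarrow> norm (f t) \<le> K"
    using compact_continuous_image[OF f] compact_imp_bounded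
    by (metis bounded_iff compact_Icc imageI)
  show ?thesis
  proof (rule absolutely_integrable_dominated_by_weight[OF _ m])
    show "continuous_on {0<..<1} (\<lambda>t. weight m t * f t)"
      by (intro continuous_intros continuous_on_subset[OF continuous_on_weight_Ico] continuous_on_subset[OF f]) auto
    show "norm (weight m t * f t) \<le> K * (1 - t\<^sup>2) powr Re m" if "t \<in> {0<..<1}" for t
      using that K[of t] by (simp add: norm_mult norm_weight mult.commute mult_right_mono)
  qed
qed

lemmas integrable_weight_mult =
  set_lebesgue_integral_eq_integral(1)[OF absolutely_integrable_weight_mult]

text \<open>
  Integrate the derivative of \<open>(1 - t\<^sup>2)\<^bsup>m+1\<^esup> t\<^bsup>2j+1\<^esup>\<close>, which vanishes at both ends.
\<close>
lemma moment_step: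
  assumes m: "Re m > -1"
  shows "(of_nat j + 1/2) * integral {0..1} (\<lambda>t. weight (m + 1) t * of_real (t ^ (2*j)))
         = (m + 1) * integral {0..1} (\<lambda>t. weight m t * of_real (t ^ (2*(j+1))))"
proof -
  let ?F = "\<lambda>t. weight (m + 1) t * of_real (t ^ (2*j+1))"
  let ?f = "\<lambda>t. of_nat (2*j+1) * (weight (m+1) t * of_real (t ^ (2*j)))
                  - 2 * (m + 1) * (weight m t * of_real (t ^ (2*(j+1))))"
  have "(?f has_integral (?F 1 - ?F 0)) {0..1}"
  proof (rule fundamental_theorem_of_calculus_interior)
    show "continuous_on {0..1} ?F"
      using m by (intro continuous_intros continuous_on_weight) auto
    fix t :: real assume t: "t \<in> {0<..<1}"
    have "((\<lambda>t. complex_of_real (t ^ (2*j+1))) has_vector_derivative of_real (of_nat (2*j+1) * t ^ (2*j))) (at t)"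
      by (intro has_vector_derivative_of_real DERIV_pow[THEN DERIV_cong, folded])
         (simp)
    from has_vector_derivative_mult[OF has_vector_derivative_weight this, of "m+1"] t
    show "(?F has_vector_derivative ?f t) (at t)"
      by (simp add: algebra_simps power2_eq_square)
  qed simp
  moreover have "(?f has_integral (of_nat (2*j+1) * integral {0..1} (\<lambda>t. weight (m + 1) t * of_real (t ^ (2*j)))
     - 2 * (m + 1) * integral {0..1} (\<lambda>t. weight m t * of_real (t ^ (2*(j+1)))))) {0..1}"
    using m by (intro has_integral_diff has_integral_mult_right integrable_integral integrable_weight_mult continuous_intros) auto
  ultimately have "of_nat (2*j+1) * integral {0..1} (\<lambda>t. weight (m + 1) t * of_real (t ^ (2*j)))
     - 2 * (m + 1) * integral {0..1} (\<lambda>t. weight m t * of_real (t ^ (2*(j+1)))) = 0"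
    by (auto dest: has_integral_unique)
  then show ?thesis by (simp add: field_simps)
qed

section \<open>The Beta integral with complex exponent\<close>

lemma not_nonpos_Int_if_Re_pos: "Re z > 0 \<Longrightarrow> z \<notin> \<int>\<^sub>\<le>\<^sub>0"
  by (auto elim!: nonpos_Ints_cases)

lemma pochhammer_neq_0_if_Re_pos:
  fixes z :: complex
  assumes "Re z > 0"
  shows "pochhammer z n \<noteq> 0"
proof
  assume "pochhammer z n = 0"
  then obtain k where "z = - of_nat k" by (auto simp: pochhammer_eq_0_iff)
  with assms show False by simp
qed

lemma moment_Suc:
  assumes m: "Re m > -1"
  shows "integral {0..1} (\<lambda>t. weight m t * of_real (t ^ (2 * Suc j)))
         = (1/2 + of_nat j) / (m + 3/2 + of_nat j) * integral {0..1} (\<lambda>t. weight m t * of_real (t ^ (2*j)))"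
proof -
  let ?I = "\<lambda>j. integral {0..1} (\<lambda>t. weight m t * of_real (t ^ (2*j)))"
  have "integral {0..1} (\<lambda>t. weight (m+1) t * of_real (t ^ (2*j)))
      = integral {0..1} (\<lambda>t. weight m t * of_real (t ^ (2*j)) - weight m t * of_real (t ^ (2*(j+1))))"
    by (rule arg_cong[of _ _ "integral {0..1}"]) (simp add: fun_eq_iff weight_plus1 right_diff_distrib left_diff_distrib power2_eq_square)
  also have "\<dots> = ?I j - ?I (j+1)"
    using m by (intro integral_diff integrable_weight_mult continuous_intros) auto
  finally have "(of_nat j + 1/2) * (?I j - ?I (j+1)) = (m + 1) * ?I (j+1)"
    using moment_step[OF m, of j] by simp
  then have "(m + 3/2 + of_nat j) * ?I (j+1) = (1/2 + of_nat j) * ?I j"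
    by (simp add: algebra_simps add_divide_distrib)
  moreover have "m + 3/2 + of_nat j \<noteq> 0"
    using m by (auto simp: complex_eq_iff)
  moreover have "X = d / c * Y" if "c * X = d * Y" "c \<noteq> 0" for X Y c d :: complex
    using that by (simp add: field_simps)
  ultimately show ?thesis by (simp only: Suc_eq_plus1)
qed

lemma moment_eq:
  assumes m: "Re m > -1"
  shows "integral {0..1} (\<lambda>t. weight m t * of_real (t ^ (2*j)))
         = pochhammer (1/2) j / pochhammer (m + 3/2) j * integral {0..1} (weight m)"
proof (induction j)
  case (Suc j)
  then show ?case unfolding moment_Suc[OF m] by (simp add: pochhammer_Suc mult_ac)
qed simp

lemma weight_integral_plus1:
  assumes m: "Re m > -1"
  shows "integral {0..1} (weight (m + 1)) = (m + 1) / (m + 3/2) * integral {0..1} (weight m)"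
proof -
  let ?I = "integral {0..1} (weight m)"
  have "1/2 * integral {0..1} (weight (m + 1)) = (m + 1) * ((1/2) / (m + 3/2) * ?I)"
    using moment_step[OF m, of 0] moment_Suc[OF m, of 0] by simp
  then have "2 * (1/2 * integral {0..1} (weight (m + 1))) = 2 * ((m + 1) * ((1/2) / (m + 3/2) * ?I))"
    by (simp only:)
  then show ?thesis by (simp del: distrib_left_numeral)
qed

lemma weight_integral_plus_nat:
  assumes m: "Re m > -1"
  shows "integral {0..1} (weight (m + of_nat n))
         = pochhammer (m + 1) n / pochhammer (m + 3/2) n * integral {0..1} (weight m)"
proof (induction n)
  case (Suc n)
  show ?case
    using weight_integral_plus1[of "m + of_nat n"] Suc m
    by (simp add: pochhammer_Suc algebra_simps)
qed simp

lemma weight_integral_nat: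
  "integral {0..1} (weight (of_nat n)) = pochhammer 1 n / pochhammer (3/2) n"
proof -
  \<comment> \<open>The two integrands differ at \<open>1\<close>, where \<open>0 powr 0 = 0\<close>.\<close>
  have "integral {0..1} (weight 0) = integral {0..1} (\<lambda>t::real. 1)"
  proof (rule integral_spike[where S = "{1}"])
    show "1 = weight 0 x" if "x \<in> {0..1} - {1}" for x :: real
    proof -
      have "1 - x\<^sup>2 \<noteq> 0" using that by (auto simp: power2_eq_1_iff)
      then have "(of_real (1 - x\<^sup>2) :: complex) \<noteq> 0" by (subst of_real_eq_0_iff)
      then show ?thesis unfolding weight_def by simp
    qed
  qed simp
  then show ?thesis using weight_integral_plus_nat[of 0 n] by simp
qed

lemma weight_close_to_1:
  assumes m: "Re m \<ge> 1" and t: "t \<in> {0..1}"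
  shows "norm (weight m t - 1) \<le> 2 * norm m * t\<^sup>2"
proof (cases "t = 1")
  case True
  have "1 \<le> norm m" using m complex_Re_le_cmod[of m] by linarith
  then show ?thesis using True by simp
next
  case False
  have "((\<lambda>s. - (2 * m * of_real s * weight (m - 1) s)) has_integral (weight m t - weight m 0)) {0..t}"
  proof (rule fundamental_theorem_of_calculus)
    show "(weight m has_vector_derivative - (2 * m * of_real s * weight (m - 1) s)) (at s within {0..t})"
      if "s \<in> {0..t}" for s
      using t False that by (intro has_vector_derivative_at_within[OF has_vector_derivative_weight]) auto
  qed (use t in auto)
  moreover have "norm (- (2 * m * of_real s * weight (m - 1) s)) \<le> 2 * norm m * t" if s: "s \<in> {0..t}" for s
  proof -
    have "norm (weight (m - 1) s) \<le> 1"
      using s t m by (subst norm_weight) (auto intro!: powr_le1 simp: abs_square_le_1)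
    then have "norm m * s * norm (weight (m - 1) s) \<le> norm m * t * 1"
      using s t by (intro mult_mono) auto
    then show ?thesis using s by (simp add: norm_mult)
  qed
  ultimately have "norm (weight m t - weight m 0) \<le> (2 * norm m * t) * measure lborel {0..t}"
    using t by (intro has_integral_bound_real[where S="{}"]) auto
  then show ?thesis using t by (simp add: power2_eq_square mult_ac)
qed

text \<open>
  As \<open>n\<close> grows, \<open>(1 - t\<^sup>2)\<^sup>n\<close> concentrates near \<open>t = 0\<close>, where \<open>weight m\<close> is close to \<open>1\<close>. The error
  \<open>|weight m t - 1|\<close> is at most a multiple of \<open>t\<^sup>2\<close>, and the recurrence for the moments shows that the
  second moment of \<open>(1 - t\<^sup>2)\<^sup>n\<close> is smaller than its integral by a factor of order \<open>1/n\<close>.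
\<close>
lemma weight_integral_ratio_tendsto:
  assumes m: "Re m \<ge> 1"
  shows "(\<lambda>n. integral {0..1} (weight (m + of_nat n)) / integral {0..1} (weight (of_nat n))) \<longlonglongrightarrow> 1"
proof -
  let ?I = "\<lambda>n. integral {0..1} (weight (of_nat n))"
  have I0: "?I n \<noteq> 0" for n
  proof -
    have "pochhammer (3/2) n \<noteq> (0::complex)"
      by (rule pochhammer_neq_0_if_Re_pos) simp
    then show ?thesis
      unfolding weight_integral_nat by (simp add: pochhammer_fact[symmetric])
  qed
  have bound: "norm (integral {0..1} (weight (m + of_nat n)) - ?I n) \<le> norm m / real n * norm (?I n)" if n: "n > 0" for n
  proof -
    let ?g = "\<lambda>t. weight (of_nat n) t * of_real (t ^ (2 * Suc 0))"
    have g: "?g integrable_on {0..1}" by (intro integrable_weight_mult continuous_intros) auto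
    then have gR: "(Re \<circ> ?g) integrable_on {0..1}" "integral {0..1} (Re \<circ> ?g) = Re (integral {0..1} ?g)"
      by (auto intro: integrable_linear integral_linear bounded_linear_Re)
    have eq: "integral {0..1} (weight (m + of_nat n)) - ?I n
      = integral {0..1} (\<lambda>t. weight (m + of_nat n) t - weight (of_nat n) t)"
      using integrable_weight_mult[of _ "\<lambda>_. 1"] m by (intro integral_diff[symmetric]) auto
    have "norm (integral {0..1} (weight (m + of_nat n)) - ?I n) \<le> integral {0..1} (\<lambda>t. 2 * norm m * (Re \<circ> ?g) t)"
      unfolding eq
    proof (rule integral_norm_bound_integral)
      show "(\<lambda>t. weight (m + of_nat n) t - weight (of_nat n) t) integrable_on {0..1}"
        using integrable_weight_mult[of _ "\<lambda>_. 1"] m by (intro integrable_diff) auto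
      show "(\<lambda>t. 2 * norm m * (Re \<circ> ?g) t) integrable_on {0..1}"
        using gR by (intro integrable_on_mult_right)
      fix t :: real assume t: "t \<in> {0..1}"
      have w: "weight (of_nat n) t = of_real ((1 - t\<^sup>2) powr real n)"
        using t unfolding weight_def by (subst powr_of_real[symmetric]) (auto simp: abs_square_le_1)
      have "weight (m + of_nat n) t - weight (of_nat n) t = weight (of_nat n) t * (weight m t - 1)"
        unfolding weight_def by (simp add: powr_add algebra_simps)
      then have "norm (weight (m + of_nat n) t - weight (of_nat n) t) = (1 - t\<^sup>2) powr real n * norm (weight m t - 1)"
        unfolding w by (simp add: norm_mult)
      also have "\<dots> \<le> (1 - t\<^sup>2) powr real n * (2 * norm m * t\<^sup>2)"
        by (intro mult_left_mono weight_close_to_1 m t) auto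
      also have "\<dots> = 2 * norm m * (Re \<circ> ?g) t" by (simp only: o_def w) simp
      finally show "norm (weight (m + of_nat n) t - weight (of_nat n) t) \<le> 2 * norm m * (Re \<circ> ?g) t" .
    qed
    also have "\<dots> = 2 * norm m * Re (integral {0..1} ?g)"
      by (simp only: integral_mult_right gR(2))
    also have "\<dots> \<le> 2 * norm m * norm (integral {0..1} ?g)"
      by (intro mult_left_mono complex_Re_le_cmod) auto
    also have "integral {0..1} ?g = (1/2) / (of_nat n + 3/2) * ?I n"
      using moment_Suc[of "of_nat n" 0] by simp
    also have "2 * norm m * norm \<dots> = norm m / norm (complex_of_nat n + 3/2) * norm (?I n)"
      unfolding norm_mult norm_divide norm_one norm_numeral by simp
    also have "\<dots> \<le> norm m / real n * norm (?I n)"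
    proof -
      have "real n \<le> norm (complex_of_nat n + 3/2)"
        using complex_Re_le_cmod[of "complex_of_nat n + 3/2"] by simp
      then show ?thesis using n by (intro mult_right_mono divide_left_mono mult_pos_pos) auto
    qed
    finally show ?thesis .
  qed
  have "(\<lambda>n. integral {0..1} (weight (m + of_nat n)) / ?I n - 1) \<longlonglongrightarrow> 0"
  proof (rule Lim_null_comparison)
    show "(\<lambda>n. norm m / real n) \<longlonglongrightarrow> 0" by (rule lim_const_over_n)
    show "eventually (\<lambda>n. norm (integral {0..1} (weight (m + of_nat n)) / ?I n - 1) \<le> norm m / real n) sequentially"
      using eventually_gt_at_top[of 0]
    proof eventually_elim
      case (elim n)
      have "norm (integral {0..1} (weight (m + of_nat n)) / ?I n - 1)
          = norm (integral {0..1} (weight (m + of_nat n)) - ?I n) / norm (?I n)"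
        using I0[of n] by (simp add: norm_divide[symmetric] diff_divide_distrib)
      also have "\<dots> \<le> (norm m / real n * norm (?I n)) / norm (?I n)"
        by (intro divide_right_mono bound elim) auto
      finally show ?case using I0[of n] by simp
    qed
  qed
  then show ?thesis by (rule LIM_zero_cancel)
qed

lemma pochhammer_quotient_tendsto:
  fixes a b c d :: complex
  assumes "a + b = c + d" "c \<notin> \<int>\<^sub>\<le>\<^sub>0" "d \<notin> \<int>\<^sub>\<le>\<^sub>0"
  shows "(\<lambda>n. (pochhammer c n * pochhammer d n) / (pochhammer a n * pochhammer b n))
           \<longlonglongrightarrow> Gamma a * Gamma b / (Gamma c * Gamma d)"
proof (rule Lim_transform_eventually)
  show "(\<lambda>n. Gamma_series' a n * Gamma_series' b n / (Gamma_series' c n * Gamma_series' d n))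
           \<longlonglongrightarrow> Gamma a * Gamma b / (Gamma c * Gamma d)"
    using assms by (intro tendsto_intros Gamma_series'_LIMSEQ) (auto simp: Gamma_eq_zero_iff)
  have *: "exp (c * x) * exp (d * x) = exp (a * x) * exp (b * x)" for x
    using assms(1) by (simp add: exp_add[symmetric] distrib_right[symmetric])
  have "Gamma_series' a n * Gamma_series' b n / (Gamma_series' c n * Gamma_series' d n)
     = (pochhammer c n * pochhammer d n) / (pochhammer a n * pochhammer b n)" for n
    using *[of "of_real (ln (of_nat n))"] by (simp add: Gamma_series'_def field_simps)
  then show "eventually (\<lambda>n. Gamma_series' a n * Gamma_series' b n / (Gamma_series' c n * Gamma_series' d n)
     = (pochhammer c n * pochhammer d n) / (pochhammer a n * pochhammer b n)) sequentially"
    by simp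
qed

text \<open>
  The Beta integral \<open>B(1/2, m + 1) / 2\<close> for complex \<open>m\<close>. The recurrence in \<open>m\<close> alone determines it up to a
  factor of period \<open>1\<close>; the limit of \<open>weight_integral_ratio_tendsto\<close> fixes that factor, because it
  turns the recurrence into the Gauss product for the Gamma function.
\<close>
lemma weight_integral:
  assumes "Re m > -1"
  shows "integral {0..1} (weight m) = of_real (sqrt pi) / 2 * Gamma (m + 1) / Gamma (m + 3/2)"
proof -
  \<comment> \<open>The ratio limit needs \<open>Re m \<ge> 1\<close>; two steps of the recurrence reach the remaining exponents.\<close>
  have large: "integral {0..1} (weight m) = of_real (sqrt pi) / 2 * Gamma (m + 1) / Gamma (m + 3/2)"
    if m: "Re m \<ge> 1" for m
  proof -
    let ?r = "\<lambda>n. integral {0..1} (weight (m + of_nat n)) / integral {0..1} (weight (of_nat n))"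
    let ?p = "\<lambda>n. (pochhammer (m+3/2) n * pochhammer 1 n) / (pochhammer (m+1) n * pochhammer (3/2) n)"
    have "integral {0..1} (weight m) = ?p n * ?r n" for n
    proof -
      have "pochhammer (m+3/2) n \<noteq> 0" "pochhammer (m+1) n \<noteq> 0" "pochhammer 1 n \<noteq> (0::complex)" "pochhammer (3/2) n \<noteq> (0::complex)"
        using m by (auto intro!: pochhammer_neq_0_if_Re_pos)
      moreover have "m + 3/2 \<noteq> 0" "m + 1 \<noteq> 0" using m by (auto simp: complex_eq_iff)
      ultimately show ?thesis using weight_integral_plus_nat[of m n] weight_integral_nat[of n] m
        by (simp add: field_simps)
    qed
    then have 1: "(\<lambda>n. ?p n * ?r n) \<longlonglongrightarrow> integral {0..1} (weight m)" by simp
    have 2: "(\<lambda>n. ?p n * ?r n) \<longlonglongrightarrow> Gamma (m+1) * Gamma (3/2) / (Gamma (m+3/2) * Gamma 1) * 1"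
      using m by (intro tendsto_mult weight_integral_ratio_tendsto pochhammer_quotient_tendsto not_nonpos_Int_if_Re_pos) auto
    have "Gamma (3/2) = of_real (sqrt pi) / (2::complex)"
      using Gamma_plus1[of "1/2::complex"] not_nonpos_Int_if_Re_pos[of "1/2"] by (simp add: Gamma_one_half_complex)
    with LIMSEQ_unique[OF 1 2] show ?thesis by simp
  qed
  have step: "integral {0..1} (weight m) = of_real (sqrt pi) / 2 * Gamma (m + 1) / Gamma (m + 3/2)"
    if m: "Re m > -1" and
       IH: "integral {0..1} (weight (m+1)) = of_real (sqrt pi) / 2 * Gamma (m + 1 + 1) / Gamma (m + 1 + 3/2)" for m
  proof -
    have nz: "m + 1 \<noteq> 0" "m + 3/2 \<noteq> 0" using m by (auto simp: complex_eq_iff)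
    have "m + 1 \<notin> \<int>\<^sub>\<le>\<^sub>0" "m + 3/2 \<notin> \<int>\<^sub>\<le>\<^sub>0"
      using m by (auto intro!: not_nonpos_Int_if_Re_pos)
    then have G: "Gamma (m + 1 + 1) = (m+1) * Gamma (m+1)" "Gamma (m + 1 + 3/2) = (m + 3/2) * Gamma (m+3/2)" "Gamma (m + 3/2) \<noteq> 0"
      using Gamma_plus1[of "m+1"] Gamma_plus1[of "m+3/2"] by (auto simp: algebra_simps Gamma_eq_zero_iff)
    have cancel: "I = s / 2 * G / H" if "c / d * I = s / 2 * (c * G) / (d * H)" "c \<noteq> 0" "d \<noteq> 0" "H \<noteq> 0"
      for I s G H c d :: complex
      using that by (simp add: field_simps)
    show ?thesis
      using IH unfolding weight_integral_plus1[OF m] G(1,2) by (rule cancel[OF _ nz G(3)])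
  qed
  show ?thesis
  proof (rule step)
    show "integral {0..1} (weight (m+1)) = of_real (sqrt pi) / 2 * Gamma (m + 1 + 1) / Gamma (m + 1 + 3/2)"
      by (rule step[OF _ large]) (use assms in simp_all)
  qed fact
qed

section \<open>Poisson's integral for Bessel functions\<close>

text \<open>
  The normalisation makes \<open>poisson \<nu>\<close> send \<open>cos (x t)\<close> to \<open>J\<^sub>\<nu>(x) (x/2)\<^sup>-\<^sup>\<nu>\<close>.
\<close>
definition poisson :: "complex \<Rightarrow> (real \<Rightarrow> complex) \<Rightarrow> complex" where
  "poisson \<nu> f = 2 / (of_real (sqrt pi) * Gamma (\<nu> + 1/2)) * integral {0..1} (\<lambda>t. weight (\<nu> - 1/2) t * f t)"

lemma poisson_cong: "(\<And>t. t \<in> {0..1} \<Longrightarrow> f t = g t) \<Longrightarrow> poisson \<nu> f = poisson \<nu> g"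
  unfolding poisson_def by (intro arg_cong2[of _ _ _ _ "(*)"] Henstock_Kurzweil_Integration.integral_cong) auto

lemma poisson_mult_left: "poisson \<nu> (\<lambda>t. c * f t) = c * poisson \<nu> f"
  unfolding poisson_def by (simp add: mult.left_commute[of _ c])

context
  fixes \<nu> :: complex
  assumes \<nu>: "Re \<nu> > -1/2"
begin

lemma poisson_add:
  assumes "continuous_on {0..1} f" "continuous_on {0..1} g"
  shows "poisson \<nu> (\<lambda>t. f t + g t) = poisson \<nu> f + poisson \<nu> g"
  using assms \<nu> unfolding poisson_def distrib_left
  by (subst integral_add) (auto intro!: integrable_weight_mult simp: distrib_left)

lemma poisson_diff:
  assumes "continuous_on {0..1} f" "continuous_on {0..1} g"
  shows "poisson \<nu> (\<lambda>t. f t - g t) = poisson \<nu> f - poisson \<nu> g"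
  using assms \<nu> unfolding poisson_def right_diff_distrib
  by (subst integral_diff) (auto intro!: integrable_weight_mult simp: right_diff_distrib)

lemma poisson_sum:
  assumes "\<And>i. i \<in> I \<Longrightarrow> continuous_on {0..1} (f i)"
  shows "poisson \<nu> (\<lambda>t. \<Sum>i\<in>I. f i t) = (\<Sum>i\<in>I. poisson \<nu> (f i))"
  using assms
proof (induction I rule: infinite_finite_induct)
  case (insert i I)
  then show ?case
    by (simp add: poisson_add continuous_on_sum)
qed (auto simp: poisson_def)

lemma poisson_bounded:
  obtains C where "C \<ge> 0"
    and "\<And>f B. \<lbrakk>continuous_on {0..1} f; \<And>t. t \<in> {0..1} \<Longrightarrow> norm (f t) \<le> B\<rbrakk> \<Longrightarrow> norm (poisson \<nu> f) \<le> C * B"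
proof
  let ?r = "Re (\<nu> - 1/2)"
  let ?C = "norm (2 / (of_real (sqrt pi) * Gamma (\<nu> + 1/2))) * integral {0..1} (\<lambda>t. (1 - t\<^sup>2) powr ?r)"
  have int: "(\<lambda>t. (1 - t\<^sup>2) powr ?r) integrable_on {0..1}"
    using \<nu> by (intro integrable_one_minus_sq_powr) auto
  show "?C \<ge> 0"
    by (intro mult_nonneg_nonneg Henstock_Kurzweil_Integration.integral_nonneg int) auto
  fix f :: "real \<Rightarrow> complex" and B assume f: "continuous_on {0..1} f" and B: "\<And>t. t \<in> {0..1} \<Longrightarrow> norm (f t) \<le> B"
  have "norm (integral {0..1} (\<lambda>t. weight (\<nu> - 1/2) t * f t)) \<le> integral {0..1} (\<lambda>t. (1 - t\<^sup>2) powr ?r * B)"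
  proof (rule Henstock_Kurzweil_Integration.integral_norm_bound_integral)
    show "norm (weight (\<nu> - 1/2) t * f t) \<le> (1 - t\<^sup>2) powr ?r * B" if "t \<in> {0..1}" for t
      using that B by (simp add: norm_mult norm_weight mult_left_mono)
  qed (use f \<nu> int in \<open>auto intro!: integrable_weight_mult integrable_on_mult_left\<close>)
  also have "\<dots> = integral {0..1} (\<lambda>t. (1 - t\<^sup>2) powr ?r) * B" by simp
  finally show "norm (poisson \<nu> f) \<le> ?C * B"
    unfolding poisson_def norm_mult by (simp only: mult.assoc mult_left_mono norm_ge_zero)
qed

lemma poisson_uniform_limit:
  assumes lim: "uniform_limit {0..1} F f sequentially" and F: "\<And>n. continuous_on {0..1} (F n)"
  shows "(\<lambda>n. poisson \<nu> (F n)) \<longlonglongrightarrow> poisson \<nu> f"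
proof -
  obtain C where C: "C \<ge> 0" 
     "\<And>f B. \<lbrakk>continuous_on {0..1} f; \<And>t. t \<in> {0..1} \<Longrightarrow> norm (f t) \<le> B\<rbrakk> \<Longrightarrow> norm (poisson \<nu> f) \<le> C * B"
    using poisson_bounded by blast
  have f: "continuous_on {0..1} f"
    using F by (intro uniform_limit_theorem[OF _ lim]) auto
  show ?thesis
  proof (rule tendstoI)
    fix e :: real assume e: "e > 0"
    define d where "d = e / (C + 1)"
    have d: "d > 0" "C * d < e" using e C(1) by (auto simp: d_def field_simps)
    from uniform_limitD[OF lim d(1)]
    show "\<forall>\<^sub>F n in sequentially. dist (poisson \<nu> (F n)) (poisson \<nu> f) < e"
    proof eventually_elim
      case (elim n)
      have "norm (poisson \<nu> (\<lambda>t. F n t - f t)) \<le> C * d"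
        using elim by (intro C(2) continuous_intros F f) (auto simp: dist_norm less_imp_le)
      then show ?case using d by (simp add: poisson_diff F f dist_norm)
    qed
  qed
qed

lemma poisson_even_power:
  "poisson \<nu> (\<lambda>t. of_real (t ^ (2 * j))) = pochhammer (1/2) j / Gamma (\<nu> + 1 + of_nat j)"
proof -
  have m: "Re (\<nu> - 1/2) > -1" using \<nu> by simp
  have "Gamma (\<nu> + 1/2) \<noteq> 0" "\<nu> + 1 \<notin> \<int>\<^sub>\<le>\<^sub>0" "Gamma (\<nu> + 1) \<noteq> 0" "pochhammer (\<nu> + 1) j \<noteq> 0"
    using \<nu> by (auto simp: Gamma_eq_zero_iff intro!: not_nonpos_Int_if_Re_pos pochhammer_neq_0_if_Re_pos)
  moreover from this have "Gamma (\<nu> + 1 + of_nat j) = Gamma (\<nu> + 1) * pochhammer (\<nu> + 1) j"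
    by (simp add: pochhammer_Gamma)
  moreover have "\<nu> - 1/2 + 1 = \<nu> + 1/2" "\<nu> - 1/2 + 3/2 = \<nu> + 1" by simp_all
  moreover have "2 / (s * G) * (p / q * (s / 2 * G / H)) = p / (H * q)"
    if "s \<noteq> 0" "G \<noteq> 0" "H \<noteq> 0" "q \<noteq> 0" for s G p q H :: complex
    using that by simp
  moreover have "complex_of_real (sqrt pi) \<noteq> 0" by simp
  ultimately show ?thesis
    unfolding poisson_def moment_eq[OF m] weight_integral[OF m] by (simp only: not_False_eq_True)
qed

text \<open>
  On \<open>[0, 1]\<close> the series is dominated by that of its coefficients, so it may be integrated termwise.
  It is used twice: with the cosine series it gives the Bessel function, and with the binomial series
  the hypergeometric function.
\<close>
lemma poisson_power_series:
  assumes "summable (\<lambda>j. norm (a j))"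
  shows "(\<lambda>j. a j * (pochhammer (1/2) j / Gamma (\<nu> + 1 + of_nat j))) sums poisson \<nu> (\<lambda>t. \<Sum>j. a j * of_real (t ^ (2 * j)))"
proof -
  have "(\<lambda>n. poisson \<nu> (\<lambda>t. \<Sum>j<n. a j * of_real (t ^ (2 * j))))
     \<longlonglongrightarrow> poisson \<nu> (\<lambda>t. \<Sum>j. a j * of_real (t ^ (2 * j)))"
  proof (rule poisson_uniform_limit)
    show "uniform_limit {0..1} (\<lambda>n t. \<Sum>j<n. a j * of_real (t ^ (2 * j))) (\<lambda>t. \<Sum>j. a j * of_real (t ^ (2 * j))) sequentially"
    proof (rule Weierstrass_m_test)
      show "norm (a j * of_real (t ^ (2*j))) \<le> norm (a j)" if "t \<in> {0..1}" for j and t :: real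
      proof -
        have "\<bar>t\<bar> ^ (2*j) \<le> 1" using that by (intro power_le_one) auto
        then show ?thesis by (simp add: norm_mult norm_power mult_left_le)
      qed
    qed fact
  qed (intro continuous_intros)
  also have "(\<lambda>n. poisson \<nu> (\<lambda>t. \<Sum>j<n. a j * of_real (t ^ (2 * j))))
     = (\<lambda>n. \<Sum>j<n. a j * (pochhammer (1/2) j / Gamma (\<nu> + 1 + of_nat j)))"
    by (subst poisson_sum) (auto intro!: continuous_intros simp only: poisson_mult_left poisson_even_power)
  finally show ?thesis unfolding sums_def .
qed

lemma pochhammer_half_over_fact: "pochhammer (1/2) j / fact (2*j) = (1 / (4^j * fact j) :: complex)"
proof -
  have "fact (2*j) = (4^j * pochhammer (1/2) j * fact j :: complex)"
    using fact_double[of j, where ?'a = complex] by (simp add: power_mult)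
  moreover have "pochhammer (1/2) j \<noteq> (0::complex)" by (rule pochhammer_neq_0_if_Re_pos) simp
  ultimately show ?thesis by simp
qed

lemma poisson_cos_sums:
  "(\<lambda>n. (-1) ^ n / (Gamma (\<nu> + of_nat n + 1) * fact n) * of_real (x / 2) ^ (2 * n)) sums
      poisson \<nu> (\<lambda>t. of_real (cos (x * t)))"
proof -
  let ?a = "\<lambda>j. of_real ((-1) ^ j / fact (2*j) * x ^ (2*j)) :: complex"
  have "summable (\<lambda>j. norm (?a j))"
  proof -
    have "summable (\<lambda>j. inverse (fact j) * (x\<^sup>2) ^ j)" by (rule summable_exp)
    then show ?thesis
    proof (rule summable_comparison_test')
      fix j :: nat
      have "(1::real) / fact (2*j) \<le> 1 / fact j" by (intro divide_left_mono fact_mono) auto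
      then have "1 / fact (2*j) * \<bar>x\<bar> ^ (2*j) \<le> 1 / fact j * \<bar>x\<bar> ^ (2*j)"
        by (rule mult_right_mono) auto
      moreover have "norm (norm (?a j)) = 1 / fact (2*j) * \<bar>x\<bar> ^ (2*j)"
        by (simp only: norm_of_real real_norm_def abs_idempotent) (simp add: abs_mult power_abs)
      moreover have "\<bar>x\<bar> ^ (2*j) = (x\<^sup>2) ^ j" by (simp add: power_mult)
      ultimately show "norm (norm (?a j)) \<le> inverse (fact j) * (x\<^sup>2) ^ j"
        by (simp add: divide_inverse)
    qed
  qed
  from poisson_power_series[OF this]
  have "(\<lambda>j. ?a j * (pochhammer (1/2) j / Gamma (\<nu> + 1 + of_nat j))) sums poisson \<nu> (\<lambda>t. \<Sum>j. ?a j * of_real (t ^ (2 * j)))" .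
  also have "(\<lambda>t. \<Sum>j. ?a j * of_real (t ^ (2 * j))) = (\<lambda>t. of_real (cos (x * t)))"
  proof
    fix t
    have "(\<lambda>j. (-1) ^ j / fact (2*j) * (x * t) ^ (2*j)) sums cos (x * t)"
      using cos_paired[of "x*t"] by simp
    from sums_of_real[OF this, where ?'a = complex]
    show "(\<Sum>j. ?a j * of_real (t ^ (2 * j))) = of_real (cos (x * t))"
      by (simp add: sums_iff power_mult_distrib mult_ac)
  qed
  also have "(\<lambda>j. ?a j * (pochhammer (1/2) j / Gamma (\<nu> + 1 + of_nat j)))
      = (\<lambda>n. (-1) ^ n / (Gamma (\<nu> + of_nat n + 1) * fact n) * of_real (x / 2) ^ (2 * n))"
  proof
    fix j
    have "?a j * (pochhammer (1/2) j / Gamma (\<nu> + 1 + of_nat j))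
       = (-1) ^ j * of_real x ^ (2*j) / Gamma (\<nu> + of_nat j + 1) * (pochhammer (1/2) j / fact (2*j))"
      by (simp add: add_ac)
    also have "\<dots> = (-1) ^ j / (Gamma (\<nu> + of_nat j + 1) * fact j) * of_real (x / 2) ^ (2 * j)"
    proof -
      have "(4::complex) ^ j = (2 ^ j)\<^sup>2" by (simp add: power2_eq_square flip: power_mult_distrib)
      then show ?thesis
        unfolding pochhammer_half_over_fact by (simp add: power_divide power_mult mult_ac)
    qed
    finally show "?a j * (pochhammer (1/2) j / Gamma (\<nu> + 1 + of_nat j))
       = (-1) ^ j / (Gamma (\<nu> + of_nat j + 1) * fact j) * of_real (x / 2) ^ (2 * j)" .
  qed
  finally show ?thesis .
qed

lemma Bessel_J_quot_eq_poisson: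
  assumes "x \<ge> 0"
  shows "Bessel_J_quot \<nu> (of_real x) = poisson \<nu> (\<lambda>t. of_real (cos (x * t)))"
proof (cases "x = 0")
  case True
  then show ?thesis using poisson_even_power[of 0] by (simp add: Bessel_J_quot_def)
next
  case False
  let ?z = "complex_of_real (x/2)"
  let ?f = "\<lambda>n. (-1) ^ n / (Gamma (\<nu> + of_nat n + 1) * fact n) * ?z ^ (2 * n)"
  have z: "?z \<noteq> 0" using False by simp
  have "?z powr (\<nu> + 2 * of_nat n) = ?z powr \<nu> * ?z ^ (2 * n)" for n
    using z powr_nat'[of ?z "2*n"] by (simp add: powr_add)
  then have "Bessel_J \<nu> (of_real x) = (\<Sum>n. ?z powr \<nu> * ?f n)"
    by (simp add: Bessel_J_def mult_ac)
  also have "\<dots> = ?z powr \<nu> * poisson \<nu> (\<lambda>t. of_real (cos (x * t)))"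
    using sums_mult[OF poisson_cos_sums] by (rule sums_unique[symmetric])
  finally show ?thesis using False z by (simp add: Bessel_J_quot_def)
qed

end

section \<open>Oscillatory integrals with an algebraic singularity\<close>

lemma absolutely_integrable_mult_bounded_continuous:
  fixes f g :: "real \<Rightarrow> complex"
  assumes "continuous_on {a..b} f" "g absolutely_integrable_on {a..b}"
  shows "(\<lambda>t. f t * g t) absolutely_integrable_on {a..b}"
proof (rule absolutely_integrable_bounded_measurable_product[OF bilinear_times])
  show "f \<in> borel_measurable (lebesgue_on {a..b})"
    using assms by (intro continuous_imp_measurable_on_sets_lebesgue) auto
  show "bounded (f ` {a..b})"
    using assms compact_continuous_image compact_imp_bounded by blast
qed (use assms in auto)

lemma
  fixes f g :: "real \<Rightarrow> complex"
  assumes f: "continuous_on {a..b} f" "\<And>t. t \<in> {a..b} \<Longrightarrow> norm (f t) \<le> 1" and g: "g absolutely_integrable_on {a..b}"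
  shows integrable_mult_bounded_continuous: "(\<lambda>t. f t * g t) integrable_on {a..b}"
    and norm_integral_mult_le: "norm (integral {a..b} (\<lambda>t. f t * g t)) \<le> integral {a..b} (\<lambda>t. norm (g t))"
proof -
  show int: "(\<lambda>t. f t * g t) integrable_on {a..b}"
    using absolutely_integrable_mult_bounded_continuous[OF f(1) g]
    by (simp add: set_lebesgue_integral_eq_integral)
  show "norm (integral {a..b} (\<lambda>t. f t * g t)) \<le> integral {a..b} (\<lambda>t. norm (g t))"
  proof (rule Henstock_Kurzweil_Integration.integral_norm_bound_integral[OF int])
    show "(\<lambda>t. norm (g t)) integrable_on {a..b}"
      using g by (simp add: absolutely_integrable_on_def)
    show "norm (f t * g t) \<le> norm (g t)" if "t \<in> {a..b}" for t
      using f(2)[OF that] by (simp add: norm_mult mult_left_le_one_le)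
  qed
qed

lemma integral_cos_by_parts:
  fixes G G' :: "real \<Rightarrow> complex"
  assumes "0 \<le> c" "x \<noteq> 0" and cont: "continuous_on {0..c} G"
    and deriv: "\<And>t. t \<in> {0<..<c} \<Longrightarrow> (G has_vector_derivative G' t) (at t)"
    and G': "G' absolutely_integrable_on {0..c}"
  shows "integral {0..c} (\<lambda>t. of_real (cos (x * t)) * G t)
           = (of_real (sin (x * c)) * G c - integral {0..c} (\<lambda>t. of_real (sin (x * t)) * G' t)) / of_real x"
proof -
  let ?F = "\<lambda>t. of_real (sin (x * t)) * G t"
  let ?f = "\<lambda>t. of_real x * (of_real (cos (x * t)) * G t) + of_real (sin (x * t)) * G' t"
  have "(?f has_integral (?F c - ?F 0)) {0..c}"
  proof (rule fundamental_theorem_of_calculus_interior)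
    show "continuous_on {0..c} ?F" by (intro continuous_intros cont)
    fix t assume t: "t \<in> {0<..<c}"
    have "((\<lambda>t. of_real (sin (x * t)) :: complex) has_vector_derivative of_real (x * cos (x * t))) (at t)"
      by (rule has_vector_derivative_of_real) (auto intro!: derivative_eq_intros)
    from has_vector_derivative_mult[OF this deriv[OF t]]
    show "(?F has_vector_derivative ?f t) (at t)" by (simp add: algebra_simps)
  qed fact
  moreover have "(?f has_integral (of_real x * integral {0..c} (\<lambda>t. of_real (cos (x * t)) * G t)
       + integral {0..c} (\<lambda>t. of_real (sin (x * t)) * G' t))) {0..c}"
    by (intro has_integral_add has_integral_mult_right integrable_integral integrable_continuous_real
          integrable_mult_bounded_continuous continuous_intros cont G') auto
  ultimately have "?F c - ?F 0 = of_real x * integral {0..c} (\<lambda>t. of_real (cos (x * t)) * G t)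
       + integral {0..c} (\<lambda>t. of_real (sin (x * t)) * G' t)"
    by (rule has_integral_unique)
  then show ?thesis using \<open>x \<noteq> 0\<close> by (simp add: field_simps)
qed

lemma integral_sin_by_parts:
  fixes G G' :: "real \<Rightarrow> complex"
  assumes "0 \<le> c" "x \<noteq> 0" and cont: "continuous_on {0..c} G"
    and deriv: "\<And>t. t \<in> {0<..<c} \<Longrightarrow> (G has_vector_derivative G' t) (at t)"
    and G': "G' absolutely_integrable_on {0..c}"
  shows "integral {0..c} (\<lambda>t. of_real (sin (x * t)) * G t)
           = (G 0 - of_real (cos (x * c)) * G c + integral {0..c} (\<lambda>t. of_real (cos (x * t)) * G' t)) / of_real x"
proof -
  let ?F = "\<lambda>t. of_real (cos (x * t)) * G t"
  let ?f = "\<lambda>t. of_real (- x) * (of_real (sin (x * t)) * G t) + of_real (cos (x * t)) * G' t"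
  have "(?f has_integral (?F c - ?F 0)) {0..c}"
  proof (rule fundamental_theorem_of_calculus_interior)
    show "continuous_on {0..c} ?F" by (intro continuous_intros cont)
    fix t assume t: "t \<in> {0<..<c}"
    have "((\<lambda>t. of_real (cos (x * t)) :: complex) has_vector_derivative of_real (- x * sin (x * t))) (at t)"
      by (rule has_vector_derivative_of_real) (auto intro!: derivative_eq_intros)
    from has_vector_derivative_mult[OF this deriv[OF t]]
    show "(?F has_vector_derivative ?f t) (at t)" by (simp add: algebra_simps)
  qed fact
  moreover have "(?f has_integral (of_real (- x) * integral {0..c} (\<lambda>t. of_real (sin (x * t)) * G t)
       + integral {0..c} (\<lambda>t. of_real (cos (x * t)) * G' t))) {0..c}"
    by (intro has_integral_add has_integral_mult_right integrable_integral integrable_continuous_real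
          integrable_mult_bounded_continuous continuous_intros cont G') auto
  ultimately have "?F c - ?F 0 = of_real (- x) * integral {0..c} (\<lambda>t. of_real (sin (x * t)) * G t)
       + integral {0..c} (\<lambda>t. of_real (cos (x * t)) * G' t)"
    by (rule has_integral_unique)
  then show ?thesis using \<open>x \<noteq> 0\<close> by (simp add: field_simps)
qed

text \<open>
  Near \<open>t = 1\<close> the integral of \<open>|weight m|\<close> is small; on the rest of the interval the weight is smooth and
  one integration by parts gains a factor \<open>1/x\<close>.
\<close>
lemma riemann_lebesgue_weight:
  assumes m: "Re m > -1"
  shows "((\<lambda>x. integral {0..1} (\<lambda>t. weight m t * of_real (cos (x * t)))) \<longlongrightarrow> 0) at_top"
proof (rule tendstoI)
  fix e :: real assume e: "e > 0"
  let ?n = "\<lambda>t. norm (weight m t)"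
  have W: "weight m absolutely_integrable_on {0..1}"
    using absolutely_integrable_weight_mult[OF m, of "\<lambda>_. 1"] by simp
  then have n: "?n integrable_on {0..1}" by (simp add: absolutely_integrable_on_def)
  obtain d where d: "d > 0" "\<forall>t. 1 - d < t \<and> t \<le> 1 \<longrightarrow> norm (integral {0..1} ?n - integral {0..t} ?n) < e/2"
    by (rule indefinite_integral_continuous_left[OF n, of 1 "e/2"]) (use e in auto)
  define c where "c = max (1/2) (1 - d/2)"
  have c: "0 < c" "c < 1" "norm (integral {0..1} ?n - integral {0..c} ?n) < e/2"
    using d by (auto simp: c_def)
  have tail: "norm (integral {c..1} (\<lambda>t. of_real (cos (x * t)) * weight m t)) < e/2" for x
  proof -
    have "norm (integral {c..1} (\<lambda>t. of_real (cos (x * t)) * weight m t)) \<le> integral {c..1} ?n"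
      by (intro norm_integral_mult_le continuous_intros absolutely_integrable_on_subinterval[OF W]) (use c in auto)
    also have "\<dots> = integral {0..1} ?n - integral {0..c} ?n"
      using Henstock_Kurzweil_Integration.integral_combine[OF _ _ n, of c] c by simp
    finally show ?thesis using c(3) unfolding real_norm_def by linarith
  qed
  let ?W' = "\<lambda>t. - (2 * m * of_real t * weight (m - 1) t)"
  have contc: "continuous_on {0..c} (weight m')" for m'
    by (rule continuous_on_subset[OF continuous_on_weight_Ico]) (use c in auto)
  have W': "?W' absolutely_integrable_on {0..c}"
    by (intro absolutely_integrable_continuous_real continuous_intros contc)
  define K where "K = norm (weight m c) + integral {0..c} (\<lambda>t. norm (?W' t))"
  have head: "norm (integral {0..c} (\<lambda>t. of_real (cos (x * t)) * weight m t)) \<le> K / x" if x: "x > 0" for x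
  proof -
    have "integral {0..c} (\<lambda>t. of_real (cos (x * t)) * weight m t)
        = (of_real (sin (x * c)) * weight m c - integral {0..c} (\<lambda>t. of_real (sin (x * t)) * ?W' t)) / of_real x"
      by (intro integral_cos_by_parts contc W' has_vector_derivative_weight) (use x c in auto)
    also have "norm \<dots> \<le> (1 * norm (weight m c) + integral {0..c} (\<lambda>t. norm (?W' t))) / x"
    proof -
      have "norm (of_real (sin (x * c)) * weight m c) \<le> 1 * norm (weight m c)"
        unfolding norm_mult by (intro mult_right_mono) auto
      moreover have "norm (integral {0..c} (\<lambda>t. of_real (sin (x * t)) * ?W' t)) \<le> integral {0..c} (\<lambda>t. norm (?W' t))"
        by (intro norm_integral_mult_le W' continuous_intros) auto
      ultimately have "norm (of_real (sin (x * c)) * weight m c - integral {0..c} (\<lambda>t. of_real (sin (x * t)) * ?W' t))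
          \<le> 1 * norm (weight m c) + integral {0..c} (\<lambda>t. norm (?W' t))"
        by (rule norm_triangle_le_diff[OF add_mono])
      moreover have "norm (complex_of_real x) = x" using x by simp
      ultimately show ?thesis
        using x by (simp only: norm_divide divide_right_mono less_imp_le)
    qed
    finally show ?thesis by (simp add: K_def)
  qed
  have "((\<lambda>x. K / x) \<longlongrightarrow> 0) at_top"
    by (intro tendsto_divide_0[OF tendsto_const] filterlim_at_top_imp_at_infinity filterlim_ident)
  from order_tendstoD(2)[OF this, of "e/2"] e have "\<forall>\<^sub>F x in at_top. K / x < e/2" by simp
  with eventually_gt_at_top[of 0]
  show "\<forall>\<^sub>F x in at_top. dist (integral {0..1} (\<lambda>t. weight m t * of_real (cos (x * t)))) 0 < e"
  proof eventually_elim
    case (elim x)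
    have "(\<lambda>t. of_real (cos (x * t)) * weight m t) integrable_on {0..1}"
      by (intro integrable_mult_bounded_continuous continuous_intros W) auto
    then have "integral {0..1} (\<lambda>t. of_real (cos (x * t)) * weight m t)
        = integral {0..c} (\<lambda>t. of_real (cos (x * t)) * weight m t) + integral {c..1} (\<lambda>t. of_real (cos (x * t)) * weight m t)"
      using c by (intro Henstock_Kurzweil_Integration.integral_combine[symmetric]) auto
    also have "norm \<dots> < e/2 + e/2"
      by (rule norm_triangle_lt, rule add_strict_mono[OF le_less_trans[OF head] tail]) (use elim in auto)
    finally show ?case by (simp add: mult.commute)
  qed
qed

text \<open>
  Two integrations by parts. In the first the sine vanishes at \<open>0\<close>, so only \<open>G 1 = 0\<close> is asked for; in the
  second the cosine vanishes at neither end, so \<open>G1\<close> must vanish at both.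
\<close>
lemma integral_cos_decay:
  fixes G G1 G2 :: "real \<Rightarrow> complex"
  assumes "continuous_on {0..1} G" "continuous_on {0..1} G1" "G2 absolutely_integrable_on {0..1}"
    and "\<And>t. t \<in> {0<..<1} \<Longrightarrow> (G has_vector_derivative G1 t) (at t)"
    and "\<And>t. t \<in> {0<..<1} \<Longrightarrow> (G1 has_vector_derivative G2 t) (at t)"
    and "G 1 = 0" "G1 0 = 0" "G1 1 = 0" and x: "x > 0"
  shows "norm (integral {0..1} (\<lambda>t. of_real (cos (x * t)) * G t)) \<le> integral {0..1} (\<lambda>t. norm (G2 t)) / x\<^sup>2"
proof -
  have G1: "G1 absolutely_integrable_on {0..1}"
    by (intro absolutely_integrable_continuous_real assms)
  have "integral {0..1} (\<lambda>t. of_real (cos (x * t)) * G t) = - integral {0..1} (\<lambda>t. of_real (sin (x * t)) * G1 t) / of_real x"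
    using assms by (subst integral_cos_by_parts[OF _ _ _ _ G1]) auto
  also have "\<dots> = - (integral {0..1} (\<lambda>t. of_real (cos (x * t)) * G2 t) / of_real x) / of_real x"
    using assms by (subst integral_sin_by_parts[OF _ _ _ _ assms(3)]) auto
  also have "norm \<dots> = norm (integral {0..1} (\<lambda>t. of_real (cos (x * t)) * G2 t)) / x\<^sup>2"
    using x by (simp add: norm_divide norm_mult power2_eq_square)
  also have "\<dots> \<le> integral {0..1} (\<lambda>t. norm (G2 t)) / x\<^sup>2"
    using assms by (intro divide_right_mono norm_integral_mult_le continuous_intros) auto
  finally show ?thesis .
qed

lemma continuous_on_dominated_by_weight:
  fixes f :: "real \<Rightarrow> complex"
  assumes "continuous_on {0..<1} f" "Re m > 0"
    and bound: "\<And>t. t \<in> {0..1} \<Longrightarrow> norm (f t) \<le> K * norm (weight m t)"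
  shows "continuous_on {0..1} f"
  unfolding continuous_on_def
proof
  fix t :: real assume t: "t \<in> {0..1}"
  show "(f \<longlongrightarrow> f t) (at t within {0..1})"
  proof (cases "t = 1")
    case True
    have "(weight m \<longlongrightarrow> weight m 1) (at 1 within {0..1})"
      using continuous_on_weight[OF \<open>Re m > 0\<close>] unfolding continuous_on_def by (rule bspec) simp
    from tendsto_mult[OF tendsto_const tendsto_norm[OF this], of K] have "(f \<longlongrightarrow> 0) (at 1 within {0..1})"
      by (intro Lim_null_comparison[of f]) (auto simp: eventually_at_filter bound)
    moreover have "f 1 = 0" using bound[of 1] by simp
    ultimately show ?thesis using True by simp
  next
    case False
    then have "(f \<longlongrightarrow> f t) (at t within {0..<1})"
      using assms(1) t unfolding continuous_on_def by auto
    also have "at t within {0..<1} = at t within {0..1}"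
      by (rule at_within_nhd[of _ "{..<1}"]) (use t False in auto)
    finally show ?thesis .
  qed
qed

lemma abs_cos_diff_le: "\<bar>cos x - cos y\<bar> \<le> \<bar>x\<^sup>2 - y\<^sup>2\<bar> / (2::real)"
proof -
  have "\<bar>cos x - cos y\<bar> = 2 * (\<bar>sin ((x + y) / 2)\<bar> * \<bar>sin ((y - x) / 2)\<bar>)"
    by (simp add: cos_diff_cos abs_mult)
  also have "\<dots> \<le> 2 * (\<bar>(x + y) / 2\<bar> * \<bar>(y - x) / 2\<bar>)"
    by (intro mult_left_mono mult_mono abs_sin_x_le_abs_x) auto
  also have "\<dots> = \<bar>(x + y) * (y - x)\<bar> / 2"
    by (simp add: abs_mult)
  also have "(x + y) * (y - x) = - (x\<^sup>2 - y\<^sup>2)" by (simp add: algebra_simps power2_eq_square)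
  finally show ?thesis by simp
qed

text \<open>
  The factor \<open>cos (a t) - cos a\<close> vanishes at \<open>t = 1\<close> to first order, like \<open>1 - t\<^sup>2\<close>. Its square therefore pays
  for two derivatives of the weight: the second derivative of the product is still dominated by
  \<open>(1 - t\<^sup>2)\<^bsup>Re m\<^esup>\<close>, hence integrable, and the product and its first derivative vanish at \<open>1\<close>.
\<close>
lemma weight_cos_diff_decay:
  fixes a :: real and m :: complex
  assumes m: "Re m > -1"
  obtains C where "\<And>x. x > 0 \<Longrightarrow>
    norm (integral {0..1} (\<lambda>t. weight m t * (of_real ((cos (a * t) - cos a)\<^sup>2) * of_real (cos (x * t))))) \<le> C / x\<^sup>2"
    and "continuous_on {0..1} (\<lambda>t. weight m t * of_real ((cos (a * t) - cos a)\<^sup>2))"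
proof -
  define D where "D = (\<lambda>t. complex_of_real (cos (a * t) - cos a))"
  define D1 where "D1 = (\<lambda>t. complex_of_real (- a * sin (a * t)))"
  define D2 where "D2 = (\<lambda>t. complex_of_real (- a * (a * cos (a * t))))"
  let ?w = "weight m" and ?w1 = "weight (m - 1)" and ?w2 = "weight (m - 1 - 1)"
  \<comment> \<open>\<open>G\<close> is the product in question, and \<open>G1\<close>, \<open>G2\<close> are its first two derivatives.\<close>
  define G where "G = (\<lambda>t. ?w t * (D t * D t))"
  define G1 where "G1 = (\<lambda>t. ?w t * (2 * (D t * D1 t)) - 2 * m * (of_real t * (?w1 t * (D t * D t))))"
  define G2 where "G2 = (\<lambda>t. (?w t * (2 * (D1 t * D1 t + D t * D2 t)) - 2 * m * of_real t * ?w1 t * (2 * (D t * D1 t)))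
       - 2 * m * (?w1 t * (D t * D t) +
           of_real t * (?w1 t * (2 * (D t * D1 t)) - 2 * (m - 1) * of_real t * ?w2 t * (D t * D t))))"
  have D: "(D has_vector_derivative D1 t) (at t)" for t
    unfolding D_def D1_def
    by (rule has_vector_derivative_of_real) (auto intro!: derivative_eq_intros)
  have D1: "(D1 has_vector_derivative D2 t) (at t)" for t
    unfolding D1_def D2_def
    by (rule has_vector_derivative_of_real) (auto intro!: derivative_eq_intros)
  have dG: "(G has_vector_derivative G1 t) (at t)" if "t \<in> {0<..<1}" for t
  proof -
    have "\<bar>t\<bar> < 1" using that by auto
    from has_vector_derivative_mult[OF has_vector_derivative_weight[OF this] has_vector_derivative_mult[OF D[of t] D[of t]]]
    show ?thesis unfolding G_def G1_def by (simp add: algebra_simps)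
  qed
  have dG1: "(G1 has_vector_derivative G2 t) (at t)" if "t \<in> {0<..<1}" for t
  proof -
    have t: "\<bar>t\<bar> < 1" using that by auto
    note w = has_vector_derivative_weight[OF t]
    have DD1: "((\<lambda>t. 2 * (D t * D1 t)) has_vector_derivative 2 * (D1 t * D1 t + D t * D2 t)) (at t)"
      using has_vector_derivative_mult_right[OF has_vector_derivative_mult[OF D[of t] D1[of t]], of 2]
      by (simp add: algebra_simps)
    have DD: "((\<lambda>t. D t * D t) has_vector_derivative 2 * (D t * D1 t)) (at t)"
      using has_vector_derivative_mult[OF D[of t] D[of t]] by (simp add: algebra_simps)
    have id: "((\<lambda>t. complex_of_real t) has_vector_derivative 1) (at t)"
      using has_vector_derivative_of_real[OF DERIV_ident] by simp
    show ?thesis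
      unfolding G1_def G2_def
      by (rule has_vector_derivative_eq_rhs)
         (rule has_vector_derivative_diff has_vector_derivative_mult_right has_vector_derivative_mult w DD1 DD id
           | simp add: algebra_simps)+
  qed
  define K where "K = a\<^sup>2 / 2"
  \<comment> \<open>Each factor \<open>D\<close> compensates one lowering of the exponent of the weight.\<close>
  have DK: "norm (D t) \<le> K * (1 - t\<^sup>2)" if "t \<in> {0..1}" for t
  proof -
    have "\<bar>cos (a * t) - cos a\<bar> \<le> \<bar>(a * t)\<^sup>2 - a\<^sup>2\<bar> / 2" by (rule abs_cos_diff_le)
    also have "(a * t)\<^sup>2 - a\<^sup>2 = - (a\<^sup>2 * (1 - t\<^sup>2))" by (simp add: power_mult_distrib algebra_simps)
    also have "\<bar>\<dots>\<bar> / 2 = K * (1 - t\<^sup>2)"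
      using that by (simp add: K_def abs_mult abs_square_le_1)
    finally show ?thesis unfolding D_def by (simp only: norm_of_real)
  qed
  have D1K: "norm (D1 t) \<le> \<bar>a\<bar>" for t
    unfolding D1_def norm_of_real by (simp add: abs_mult mult_left_le)
  have D2K: "norm (D2 t) \<le> a\<^sup>2" for t
    unfolding D2_def norm_of_real by (simp add: abs_mult mult_left_le power2_eq_square mult.assoc[symmetric])
  have cD: "continuous_on S D" "continuous_on S D1" "continuous_on S D2" for S
    unfolding D_def D1_def D2_def by (intro continuous_intros)+
  have K0: "K \<ge> 0" by (simp add: K_def)
  have w_le: "norm (?w1 t) * (1 - t\<^sup>2) = norm (?w t)" "norm (?w2 t) * (1 - t\<^sup>2) = norm (?w1 t)" 
             "norm (weight (m+1) t) = norm (?w t) * (1 - t\<^sup>2)" if t: "t \<in> {0..1}" for t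
    using norm_weight_plus1[OF t, of "m - 1"] norm_weight_plus1[OF t, of "m - 1 - 1"] norm_weight_plus1[OF t, of m]
    by simp_all
  have cG1: "continuous_on {0..1} G1"
  proof (rule continuous_on_dominated_by_weight)
    show "continuous_on {0..<1} G1"
      unfolding G1_def by (intro continuous_intros cD continuous_on_weight_Ico)
    show "Re (m + 1) > 0" using m by simp
    fix t :: real assume t: "t \<in> {0..1}"
    have "norm (G1 t) \<le> norm (?w t * (2 * (D t * D1 t))) + norm (2 * m * (of_real t * (?w1 t * (D t * D t))))"
      unfolding G1_def by (rule norm_triangle_ineq4)
    also have "norm (?w t * (2 * (D t * D1 t))) = norm (?w t) * (2 * (norm (D t) * norm (D1 t)))" 
      by (simp add: norm_mult)
    also have "\<dots> \<le> norm (?w t) * (2 * ((K * (1 - t\<^sup>2)) * \<bar>a\<bar>))"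
      using t K0 by (intro mult_left_mono mult_mono DK D1K) (auto simp: abs_square_le_1)
    also have "norm (2 * m * (of_real t * (?w1 t * (D t * D t)))) = 2 * norm m * (t * (norm (?w1 t) * (norm (D t) * norm (D t))))"
      using t by (simp add: norm_mult)
    also have "\<dots> \<le> 2 * norm m * (1 * (norm (?w1 t) * ((K * (1 - t\<^sup>2)) * (K * (1 - t\<^sup>2)))))"
      using t K0 by (intro mult_left_mono mult_mono DK mult_nonneg_nonneg) (auto simp: abs_square_le_1)
    also have "\<dots> = 2 * norm m * K * K * (norm (?w1 t) * (1 - t\<^sup>2)) * (1 - t\<^sup>2)" by simp
    also have "norm (?w t) * (2 * ((K * (1 - t\<^sup>2)) * \<bar>a\<bar>)) + \<dots> = (2 * K * \<bar>a\<bar> + 2 * norm m * K * K) * norm (weight (m+1) t)"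
      unfolding w_le[OF t] by (simp add: algebra_simps)
    finally show "norm (G1 t) \<le> (2 * K * \<bar>a\<bar> + 2 * norm m * K * K) * norm (weight (m+1) t)" by simp
  qed
  have cG: "continuous_on {0..1} G"
  proof (rule continuous_on_dominated_by_weight)
    show "continuous_on {0..<1} G"
      unfolding G_def by (intro continuous_intros cD continuous_on_weight_Ico)
    show "Re (m + 1) > 0" using m by simp
    fix t :: real assume t: "t \<in> {0..1}"
    have "norm (G t) = norm (?w t) * (norm (D t) * norm (D t))" by (simp add: G_def norm_mult)
    also have "\<dots> \<le> norm (?w t) * ((K * (1 - t\<^sup>2)) * (K * 1))"
      using t K0 by (intro mult_left_mono mult_mono DK order_trans[OF DK]) (auto simp: abs_square_le_1 mult_left_le)
    finally show "norm (G t) \<le> (K * K) * norm (weight (m+1) t)"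
      unfolding w_le[OF t] by (simp add: mult_ac)
  qed
  have iG2: "G2 absolutely_integrable_on {0..1}"
  proof (rule absolutely_integrable_dominated_by_weight[OF _ m])
    have "continuous_on {0<..<1} (weight m')" for m'
      by (rule continuous_on_subset[OF continuous_on_weight_Ico]) auto
    then show "continuous_on {0<..<1} G2"
      unfolding G2_def by (intro continuous_intros cD)
    fix t :: real assume "t \<in> {0<..<1}"
    then have t: "t \<in> {0..1}" by auto
    define p where "p = 1 - t\<^sup>2"
    have p: "0 \<le> p" "p \<le> 1" using t by (auto simp: p_def abs_square_le_1)
    let ?n = "norm (?w t)" and ?M = "norm m" and ?M1 = "norm (m - 1)"
    have n1: "norm (?w1 t) * p = ?n" and n2: "norm (?w2 t) * (p * p) = ?n"
      using w_le[OF t] by (simp_all add: p_def flip: mult.assoc)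
    have d: "norm (D t) \<le> K * p" using DK[OF t] by (simp add: p_def)
    have "norm (?w t * (2 * (D1 t * D1 t + D t * D2 t))) = ?n * (2 * norm (D1 t * D1 t + D t * D2 t))"
      by (simp only: norm_mult norm_numeral)
    also have "\<dots> \<le> ?n * (2 * (\<bar>a\<bar> * \<bar>a\<bar> + K * a\<^sup>2))"
    proof -
      have "norm (D1 t * D1 t + D t * D2 t) \<le> norm (D1 t) * norm (D1 t) + norm (D t) * norm (D2 t)"
        by (metis norm_mult norm_triangle_ineq)
      also have "\<dots> \<le> \<bar>a\<bar> * \<bar>a\<bar> + (K * p) * a\<^sup>2" using K0 p by (intro add_mono mult_mono D1K D2K d) auto
      also have "\<dots> \<le> \<bar>a\<bar> * \<bar>a\<bar> + (K * 1) * a\<^sup>2" using K0 p by (intro add_mono mult_right_mono mult_left_mono) auto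
      finally show ?thesis by (intro mult_left_mono) auto
    qed
    finally have 1: "norm (?w t * (2 * (D1 t * D1 t + D t * D2 t))) \<le> (2 * (\<bar>a\<bar> * \<bar>a\<bar> + K * a\<^sup>2)) * ?n"
      by (simp add: mult_ac)
    have DD1: "norm (?w1 t) * (norm (D t) * norm (D1 t)) \<le> K * \<bar>a\<bar> * ?n"
    proof -
      have "norm (?w1 t) * (norm (D t) * norm (D1 t)) \<le> norm (?w1 t) * ((K * p) * \<bar>a\<bar>)"
        using K0 p by (intro mult_left_mono mult_mono d D1K) auto
      also have "\<dots> = K * \<bar>a\<bar> * (norm (?w1 t) * p)" by simp
      finally show ?thesis unfolding n1 .
    qed
    have DD: "norm (?w2 t) * (norm (D t) * norm (D t)) \<le> K * K * ?n"
    proof -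
      have "norm (?w2 t) * (norm (D t) * norm (D t)) \<le> norm (?w2 t) * ((K * p) * (K * p))"
        using K0 p by (intro mult_left_mono mult_mono d) auto
      also have "\<dots> = K * K * (norm (?w2 t) * (p * p))" by simp
      finally show ?thesis unfolding n2 .
    qed
    have DD': "norm (?w1 t) * (norm (D t) * norm (D t)) \<le> K * K * ?n"
    proof -
      have "norm (?w1 t) * (norm (D t) * norm (D t)) \<le> norm (?w1 t) * ((K * p) * (K * 1))"
        using K0 p by (intro mult_left_mono mult_mono d order_trans[OF d]) auto
      also have "\<dots> = K * K * (norm (?w1 t) * p)" by simp
      finally show ?thesis unfolding n1 .
    qed
    have 2: "norm (2 * m * of_real t * ?w1 t * (2 * (D t * D1 t))) \<le> 4 * ?M * (K * \<bar>a\<bar> * ?n)"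
    proof -
      have "norm (2 * m * of_real t * ?w1 t * (2 * (D t * D1 t))) = 4 * ?M * (t * (norm (?w1 t) * (norm (D t) * norm (D1 t))))"
        using t by (simp add: norm_mult)
      also have "\<dots> \<le> 4 * ?M * (1 * (K * \<bar>a\<bar> * ?n))"
        using t by (intro mult_left_mono mult_mono DD1) auto
      finally show ?thesis by simp
    qed
    have 3: "norm (?w1 t * (D t * D t)) \<le> K * K * ?n" using DD' by (simp add: norm_mult)
    have 4: "norm (of_real t * (?w1 t * (2 * (D t * D1 t)) - 2 * (m - 1) * of_real t * ?w2 t * (D t * D t)))
              \<le> 2 * (K * \<bar>a\<bar> * ?n) + 2 * ?M1 * (K * K * ?n)"
    proof -
      have a: "norm (?w1 t * (2 * (D t * D1 t))) \<le> 2 * (K * \<bar>a\<bar> * ?n)" using DD1 by (simp add: norm_mult)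
      have "norm (2 * (m - 1) * of_real t * ?w2 t * (D t * D t)) = 2 * ?M1 * (t * (norm (?w2 t) * (norm (D t) * norm (D t))))"
        using t by (simp add: norm_mult del: right_diff_distrib_numeral)
      also have "\<dots> \<le> 2 * ?M1 * (1 * (K * K * ?n))"
        using t by (intro mult_left_mono mult_mono DD) auto
      finally have b: "norm (2 * (m - 1) * of_real t * ?w2 t * (D t * D t)) \<le> 2 * ?M1 * (K * K * ?n)" by simp
      have "norm (of_real t * (?w1 t * (2 * (D t * D1 t)) - 2 * (m - 1) * of_real t * ?w2 t * (D t * D t)))
          = t * norm (?w1 t * (2 * (D t * D1 t)) - 2 * (m - 1) * of_real t * ?w2 t * (D t * D t))"
        using t by (simp add: norm_mult)
      also have "\<dots> \<le> 1 * norm (?w1 t * (2 * (D t * D1 t)) - 2 * (m - 1) * of_real t * ?w2 t * (D t * D t))"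
        using t by (intro mult_right_mono) auto
      also have "\<dots> \<le> 2 * (K * \<bar>a\<bar> * ?n) + 2 * ?M1 * (K * K * ?n)"
        using norm_triangle_le_diff[OF add_mono[OF a b]] by simp
      finally show ?thesis .
    qed
    have "norm (G2 t) \<le> ((2 * (\<bar>a\<bar> * \<bar>a\<bar> + K * a\<^sup>2)) * ?n + 4 * ?M * (K * \<bar>a\<bar> * ?n)) + 2 * ?M * (K * K * ?n + (2 * (K * \<bar>a\<bar> * ?n) + 2 * ?M1 * (K * K * ?n)))"
      unfolding G2_def
    proof (rule norm_triangle_le_diff[OF add_mono[OF norm_triangle_le_diff[OF add_mono[OF 1 2]]]])
      show "norm (2 * m * (?w1 t * (D t * D t) + of_real t * (?w1 t * (2 * (D t * D1 t)) - 2 * (m - 1) * of_real t * ?w2 t * (D t * D t))))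
        \<le> 2 * ?M * (K * K * ?n + (2 * (K * \<bar>a\<bar> * ?n) + 2 * ?M1 * (K * K * ?n)))"
        unfolding norm_mult[of "2 * m"]
        by (intro mult_mono norm_triangle_le add_mono 3 4) (auto simp: norm_mult K0)
    qed
    also have "\<dots> = (2 * (\<bar>a\<bar> * \<bar>a\<bar> + K * a\<^sup>2) + 4 * ?M * (K * \<bar>a\<bar>) + 2 * ?M * (K * K + (2 * (K * \<bar>a\<bar>) + 2 * ?M1 * (K * K)))) * ?n"
      by (simp add: algebra_simps)
    finally show "norm (G2 t) \<le> (2 * (\<bar>a\<bar> * \<bar>a\<bar> + K * a\<^sup>2) + 4 * ?M * (K * \<bar>a\<bar>) + 2 * ?M * (K * K + (2 * (K * \<bar>a\<bar>) + 2 * ?M1 * (K * K)))) * (1 - t\<^sup>2) powr Re m"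
      unfolding norm_weight[OF t] .
  qed
  have GD: "G = (\<lambda>t. weight m t * of_real ((cos (a * t) - cos a)\<^sup>2))"
    by (simp add: G_def D_def power2_eq_square)
  show thesis
  proof (rule that)
    show "continuous_on {0..1} (\<lambda>t. weight m t * of_real ((cos (a * t) - cos a)\<^sup>2))"
      using cG unfolding GD .
    fix x :: real assume x: "x > 0"
    have "norm (integral {0..1} (\<lambda>t. of_real (cos (x * t)) * G t)) \<le> integral {0..1} (\<lambda>t. norm (G2 t)) / x\<^sup>2"
      by (rule integral_cos_decay[OF cG cG1 iG2 dG dG1 _ _ _ x]) (simp_all add: G_def G1_def D_def D1_def)
    then show "norm (integral {0..1} (\<lambda>t. weight m t * (of_real ((cos (a * t) - cos a)\<^sup>2) * of_real (cos (x * t))))) 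
        \<le> integral {0..1} (\<lambda>t. norm (G2 t)) / x\<^sup>2"
      unfolding GD by (simp add: mult_ac)
  qed
qed

section \<open>Cosine series on the interval from 0 to pi\<close>

lemma cos_Suc_Suc_mult:
  fixes y :: real
  shows "cos (real (Suc (Suc n)) * y) = 2 * cos y * cos (real (Suc n) * y) - cos (real n * y)"
proof -
  have "real (Suc (Suc n)) * y = real (Suc n) * y + y" "real n * y = real (Suc n) * y - y"
    by (simp_all add: algebra_simps)
  then show ?thesis by (simp only: cos_add cos_diff) (simp add: algebra_simps)
qed

text \<open>
  Let \<open>V\<close> be the space of continuous functions all of whose cosine moments vanish. Multiplication by
  \<open>cos\<close> preserves \<open>V\<close>, and the multipliers that preserve \<open>V\<close> form an algebra, which separates the points of
  \<open>[0, \<pi>]\<close> since \<open>cos\<close> is injective there. By Stone--Weierstrass \<open>f\<close> is a uniform limit of such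
  multipliers \<open>g\<close>. Each \<open>g f\<close> lies in \<open>V\<close> and so has integral \<open>0\<close>; hence \<open>f\<^sup>2\<close> has integral \<open>0\<close>.
\<close>
lemma cosine_moments_zero_imp_zero_real:
  fixes f :: "real \<Rightarrow> real"
  assumes f: "continuous_on {0..pi} f"
    and zero: "\<And>n::nat. integral {0..pi} (\<lambda>s. f s * cos (real n * s)) = 0"
    and s: "s \<in> {0..pi}"
  shows "f s = 0"
proof -
  define V :: "(real \<Rightarrow> real) set" where
    "V = {h. continuous_on {0..pi} h \<and> (\<forall>n::nat. integral {0..pi} (\<lambda>s. h s * cos (real n * s)) = 0)}"
  define P where "P = (\<lambda>g. continuous_on {0..pi} g \<and> (\<forall>h\<in>V. (\<lambda>s. g s * h s) \<in> V))"
  have fV: "f \<in> V" using f zero by (auto simp: V_def)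
  have contV: "continuous_on {0..pi} h" if "h \<in> V" for h using that by (simp add: V_def)
  have zeroV: "integral {0..pi} (\<lambda>s. h s * cos (real n * s)) = 0" if "h \<in> V" for h n using that by (simp add: V_def)
  have int: "h integrable_on {0..pi}" if "continuous_on {0..pi} h" for h :: "real \<Rightarrow> real"
    using that by (rule integrable_continuous_real)
  have V_add: "(\<lambda>s. h s + k s) \<in> V" if "h \<in> V" "k \<in> V" for h k
    using that contV[OF that(1)] contV[OF that(2)] unfolding V_def
    by (auto simp: distrib_right Henstock_Kurzweil_Integration.integral_add int continuous_intros)
  have Pconst: "P (\<lambda>s. c)" for c
    by (auto simp: P_def V_def mult.assoc intro!: continuous_intros)
  have Pcos: "P cos"
    unfolding P_def
  proof (intro conjI ballI)
    fix h assume h: "h \<in> V"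
    have "integral {0..pi} (\<lambda>s. (cos s * h s) * cos (real n * s)) = 0" for n
    proof (cases n)
      case 0
      then show ?thesis using zeroV[OF h, of 1] by (simp add: mult.commute)
    next
      case (Suc k)
      have eq: "(\<lambda>s. (cos s * h s) * cos (real n * s))
          = (\<lambda>s. 1/2 * (h s * cos (real (Suc n) * s)) + 1/2 * (h s * cos (real k * s)))"
        unfolding Suc cos_Suc_Suc_mult by (rule ext) (simp add: right_diff_distrib diff_divide_distrib)
      show ?thesis
        unfolding eq using contV[OF h] zeroV[OF h]
        by (subst Henstock_Kurzweil_Integration.integral_add) (auto intro!: int continuous_intros simp del: of_nat_Suc)
    qed
    then show "(\<lambda>s. cos s * h s) \<in> V"
      using contV[OF h] by (auto simp: V_def intro!: continuous_intros)
  qed (intro continuous_intros)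
  have approx: "\<exists>g. P g \<and> (\<forall>x\<in>{0..pi}. \<bar>f x - g x\<bar> < e)" if "e > 0" for e
  proof (rule Stone_Weierstrass_HOL)
    show "P (\<lambda>x. g x + h x)" if "P g \<and> P h" for g h
      using that unfolding P_def by (auto simp: distrib_right intro!: continuous_intros V_add)
    show "P (\<lambda>x. g x * h x)" if "P g \<and> P h" for g h
      using that unfolding P_def by (auto simp: mult.assoc intro!: continuous_intros)
    show "\<exists>g. P g \<and> g x \<noteq> g y" if "x \<in> {0..pi} \<and> y \<in> {0..pi} \<and> x \<noteq> y" for x y
      using that Pcos cos_inj_pi[of x y] by auto
  qed (use Pconst f that in \<open>auto simp: P_def\<close>)
  have "integral {0..pi} (\<lambda>s. f s * f s) = 0"
  proof (rule ccontr)
    let ?I = "integral {0..pi} (\<lambda>s. f s * f s)" and ?J = "integral {0..pi} (\<lambda>s. \<bar>f s\<bar>)"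
    assume "?I \<noteq> 0"
    moreover have J: "?J \<ge> 0" by (intro Henstock_Kurzweil_Integration.integral_nonneg int continuous_intros f) auto
    \<comment> \<open>Approximating to this accuracy forces \<open>|?I| \<le> |?I| ?J / (?J + 1) < |?I|\<close>.\<close>
    ultimately have e: "\<bar>?I\<bar> / (?J + 1) > 0" by auto
    from approx[OF this] obtain g where g: "P g" "\<forall>x\<in>{0..pi}. \<bar>f x - g x\<bar> < \<bar>?I\<bar> / (?J + 1)" by blast
    have gf: "(\<lambda>s. g s * f s) \<in> V" and cg: "continuous_on {0..pi} g" using g(1) fV by (auto simp: P_def)
    have "?I = integral {0..pi} (\<lambda>s. (f s - g s) * f s) + integral {0..pi} (\<lambda>s. g s * f s)"
      by (subst Henstock_Kurzweil_Integration.integral_add[symmetric])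
         (auto intro!: int continuous_intros f cg simp: algebra_simps)
    also have "integral {0..pi} (\<lambda>s. g s * f s) = 0" using zeroV[OF gf, of 0] by simp
    finally have "\<bar>?I\<bar> = norm (integral {0..pi} (\<lambda>s. (f s - g s) * f s))" by simp
    also have "\<dots> \<le> integral {0..pi} (\<lambda>s. \<bar>?I\<bar> / (?J + 1) * \<bar>f s\<bar>)"
    proof (rule Henstock_Kurzweil_Integration.integral_norm_bound_integral)
      show "norm ((f x - g x) * f x) \<le> \<bar>?I\<bar> / (?J + 1) * \<bar>f x\<bar>" if "x \<in> {0..pi}" for x
        unfolding real_norm_def abs_mult using g(2) that by (intro mult_right_mono[OF less_imp_le]) auto
    qed (intro int continuous_intros f cg)+
    also have "\<dots> = \<bar>?I\<bar> / (?J + 1) * ?J" by (simp only: integral_mult_right)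
    also have "\<dots> < \<bar>?I\<bar>" using J \<open>?I \<noteq> 0\<close> by (simp add: field_simps)
    finally show False by simp
  qed
  then have "\<forall>x\<in>{0..pi}. f x * f x = 0"
    by (subst (asm) integral_eq_0_iff) (auto intro!: continuous_intros f)
  then show ?thesis using s by auto
qed

lemma cosine_moments_zero_imp_zero:
  fixes f :: "real \<Rightarrow> complex"
  assumes f: "continuous_on {0..pi} f"
    and zero: "\<And>n::nat. integral {0..pi} (\<lambda>s. f s * of_real (cos (real n * s))) = 0"
    and s: "s \<in> {0..pi}"
  shows "f s = 0"
proof -
  have int: "(\<lambda>s. f s * of_real (cos (real n * s))) integrable_on {0..pi}" for n
    by (intro integrable_continuous_real continuous_intros f)
  have "Re (f s) = 0"
  proof (rule cosine_moments_zero_imp_zero_real[OF _ _ s])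
    show "integral {0..pi} (\<lambda>s. Re (f s) * cos (real n * s)) = 0" for n
      using integral_linear[OF int bounded_linear_Re, of n] zero[of n] by (simp add: o_def)
  qed (intro continuous_intros f)
  moreover have "Im (f s) = 0"
  proof (rule cosine_moments_zero_imp_zero_real[OF _ _ s])
    show "integral {0..pi} (\<lambda>s. Im (f s) * cos (real n * s)) = 0" for n
      using integral_linear[OF int bounded_linear_Im, of n] zero[of n] by (simp add: o_def)
  qed (intro continuous_intros f)
  ultimately show ?thesis by (simp add: complex_eq_iff)
qed

definition neumann_factor :: "nat \<Rightarrow> real" where
  "neumann_factor n = (if n = 0 then 1/2 else 1)"

lemma integral_cos_mult_cos:
  "integral {0..pi} (\<lambda>s. cos (real n * s) * cos (real m * s)) = (if n = m then pi / 2 / neumann_factor n else 0)"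
proof -
  have int: "((\<lambda>s. cos (x * s)) has_integral (if x = 0 then pi else sin (x * pi) / x)) {0..pi}" for x :: real
  proof (cases "x = 0")
    case True
    then show ?thesis using has_integral_const_real[of "1::real" 0 pi] by simp
  next
    case False
    have "((\<lambda>s. cos (x * s)) has_integral (sin (x * pi) / x - sin (x * 0) / x)) {0..pi}"
      using False by (intro fundamental_theorem_of_calculus)
        (auto intro!: derivative_eq_intros simp flip: has_real_derivative_iff_has_vector_derivative)
    then show ?thesis using False by simp
  qed
  have z: "sin ((real n - real m) * pi) = 0" "sin ((real n + real m) * pi) = 0"
    by (simp_all add: left_diff_distrib distrib_right sin_diff sin_add)
  have "((\<lambda>s. 1/2 * cos ((real n - real m) * s) + 1/2 * cos ((real n + real m) * s)) has_integral
        (1/2 * (if n = m then pi else 0) + 1/2 * (if n = 0 \<and> m = 0 then pi else 0))) {0..pi}"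
    using int[of "real n - real m"] int[of "real n + real m"] unfolding z
    by (intro has_integral_add has_integral_mult_right) (auto split: if_splits)
  also have "(\<lambda>s. 1/2 * cos ((real n - real m) * s) + 1/2 * cos ((real n + real m) * s)) = (\<lambda>s. cos (real n * s) * cos (real m * s))"
    by (rule ext) (simp add: left_diff_distrib distrib_right cos_diff cos_add add_divide_distrib diff_divide_distrib)
  finally show ?thesis by (auto dest!: integral_unique simp: neumann_factor_def)
qed

definition cos_kernel :: "nat \<Rightarrow> real \<Rightarrow> real \<Rightarrow> real" where
  "cos_kernel N x s = (\<Sum>n\<le>N. neumann_factor n * cos (real n * x) * cos (real n * s))"

text \<open>
  Multiplying the kernel by \<open>cos x - cos s\<close> makes it telescope. This is what allows a partial sum of a
  cosine series to be multiplied by a trigonometric factor at the cost of its two outermost terms.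
\<close>
lemma cos_kernel_christoffel_darboux:
  "(cos x - cos s) * cos_kernel N x s
     = (cos (real (Suc N) * x) * cos (real N * s) - cos (real N * x) * cos (real (Suc N) * s)) / 2"
proof (induction N)
  case 0
  then show ?case by (simp add: cos_kernel_def neumann_factor_def)
next
  case (Suc N)
  have "cos_kernel (Suc N) x s = cos_kernel N x s + cos (real (Suc N) * x) * cos (real (Suc N) * s)"
    by (simp add: cos_kernel_def neumann_factor_def)
  then have "(cos x - cos s) * cos_kernel (Suc N) x s
     = (cos x - cos s) * cos_kernel N x s + (cos x - cos s) * (cos (real (Suc N) * x) * cos (real (Suc N) * s))"
    by (simp only: distrib_left)
  then show ?case unfolding Suc.IH cos_Suc_Suc_mult by (simp add: field_simps)
qed

section \<open>The cosine series with Bessel coefficients\<close>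

lemma poisson_cos_tendsto_0:
  assumes "Re \<mu> > -1/2"
  shows "((\<lambda>x. poisson \<mu> (\<lambda>t. of_real (cos (x * t)))) \<longlongrightarrow> 0) at_top"
  unfolding poisson_def
  by (intro tendsto_mult_right_zero riemann_lebesgue_weight) (use assms in auto)

text \<open>
  The cosine series \<open>\<Sum> \<epsilon>\<^sub>n c\<^sub>n cos (n s)\<close> with \<open>c\<^sub>n = J\<^sub>\<mu>(a n) (a n / 2)\<^sup>-\<^sup>\<mu>\<close>. Up to a constant it is the Fourier series of
  the function equal to \<open>(1 - (s/a)\<^sup>2)\<^bsup>\<mu> - 1/2\<^esup>\<close> on \<open>[0, a]\<close> and to \<open>0\<close> on \<open>[a, \<pi>]\<close>; the condition \<open>a < \<pi>\<close> leaves room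
  for that extension. The only singularity is at \<open>s = a\<close>, and the smoothed objects below belong to the
  product of that function with \<open>(cos s - cos a)\<^sup>2\<close>.
\<close>
locale cosine_series =
  fixes a :: real and \<mu> :: complex
  assumes a: "0 < a" "a < pi" and \<mu>: "Re \<mu> > -1/2"
begin

definition bessel_coeff :: "nat \<Rightarrow> complex" where
  "bessel_coeff n = poisson \<mu> (\<lambda>t. of_real (cos (real n * (a * t))))"

definition smoothed_coeff :: "nat \<Rightarrow> complex" where
  "smoothed_coeff n = poisson \<mu> (\<lambda>t. of_real ((cos (a * t) - cos a)\<^sup>2 * cos (real n * (a * t))))"

definition partial_sum :: "nat \<Rightarrow> real \<Rightarrow> complex" where
  "partial_sum N s = (\<Sum>n\<le>N. of_real (neumann_factor n * cos (real n * s)) * bessel_coeff n)"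

definition smoothed_sum :: "real \<Rightarrow> complex" where
  "smoothed_sum s = (\<Sum>n. of_real (neumann_factor n * cos (real n * s)) * smoothed_coeff n)"

lemma bessel_coeff_tendsto_0: "bessel_coeff \<longlonglongrightarrow> 0"
proof -
  have "filterlim (\<lambda>n. real n * a) at_top sequentially"
    by (rule filterlim_at_top_mult_tendsto_pos[OF tendsto_const a(1) filterlim_real_sequentially])
  from filterlim_compose[OF poisson_cos_tendsto_0[OF \<mu>] this]
  show ?thesis by (simp add: bessel_coeff_def[abs_def] mult.assoc)
qed

lemma bessel_coeff_cos_diff_tendsto_0:
  "(\<lambda>n. poisson \<mu> (\<lambda>t. of_real ((cos (a * t) - cos a) * cos (real n * (a * t))))) \<longlonglongrightarrow> 0"
proof -
  \<comment> \<open>Multiplication by \<open>cos (a t) - cos a\<close> is a second difference of the coefficients.\<close>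
  have "poisson \<mu> (\<lambda>t. of_real ((cos (a * t) - cos a) * cos (real (Suc n) * (a * t))))
      = 1/2 * (bessel_coeff (Suc (Suc n)) + bessel_coeff n) - of_real (cos a) * bessel_coeff (Suc n)" for n
  proof -
    have "poisson \<mu> (\<lambda>t. of_real ((cos (a * t) - cos a) * cos (real (Suc n) * (a * t))))
        = poisson \<mu> (\<lambda>t. 1/2 * (of_real (cos (real (Suc (Suc n)) * (a * t))) + of_real (cos (real n * (a * t))))
             - of_real (cos a) * of_real (cos (real (Suc n) * (a * t))))"
      unfolding cos_Suc_Suc_mult by (rule arg_cong[of _ _ "poisson \<mu>"]) (simp add: left_diff_distrib fun_eq_iff)
    also have "\<dots> = 1/2 * (bessel_coeff (Suc (Suc n)) + bessel_coeff n) - of_real (cos a) * bessel_coeff (Suc n)"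
    proof -
      have c: "continuous_on {0..1} (\<lambda>t. of_real (cos (real k * (a * t))) :: complex)" for k
        by (intro continuous_intros)
      show ?thesis
        unfolding bessel_coeff_def poisson_mult_left[symmetric] poisson_add[OF \<mu> c c, symmetric]
        by (rule poisson_diff[OF \<mu>]) (intro continuous_intros)+
    qed
    finally show ?thesis .
  qed
  moreover have "(\<lambda>n. 1/2 * (bessel_coeff (Suc (Suc n)) + bessel_coeff n) - of_real (cos a) * bessel_coeff (Suc n)) \<longlonglongrightarrow> 1/2 * (0 + 0) - of_real (cos a) * 0"
    by (intro tendsto_intros bessel_coeff_tendsto_0 LIMSEQ_Suc[OF bessel_coeff_tendsto_0] LIMSEQ_Suc[OF LIMSEQ_Suc[OF bessel_coeff_tendsto_0]])
  ultimately have "(\<lambda>n. poisson \<mu> (\<lambda>t. of_real ((cos (a * t) - cos a) * cos (real (Suc n) * (a * t))))) \<longlonglongrightarrow> 0"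
    by (simp only: add_0_right mult_zero_right diff_zero)
  then show ?thesis by (rule LIMSEQ_imp_Suc)
qed

lemma summable_smoothed_coeff: "summable (\<lambda>n. norm (smoothed_coeff n))"
proof -
  obtain C where C: "\<And>x. x > 0 \<Longrightarrow>
    norm (integral {0..1} (\<lambda>t. weight (\<mu> - 1/2) t * (of_real ((cos (a * t) - cos a)\<^sup>2) * of_real (cos (x * t))))) \<le> C / x\<^sup>2"
    using weight_cos_diff_decay[of "\<mu> - 1/2" a] \<mu> by auto
  let ?c = "norm (2 / (of_real (sqrt pi) * Gamma (\<mu> + 1/2)))"
  have "summable (\<lambda>n. ?c * C / a\<^sup>2 * inverse (real n ^ 2))"
    by (intro summable_mult inverse_power_summable) auto
  then show ?thesis
  proof (rule summable_comparison_test'[where N = 1])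
    fix n :: nat assume n: "n \<ge> 1"
    have "norm (smoothed_coeff n) \<le> ?c * (C / (real n * a)\<^sup>2)"
      unfolding smoothed_coeff_def poisson_def norm_mult
      using C[of "real n * a"] n a by (intro mult_left_mono) (simp_all add: mult.assoc)
    then show "norm (norm (smoothed_coeff n)) \<le> ?c * C / a\<^sup>2 * inverse (real n ^ 2)"
      by (simp add: power_mult_distrib field_simps)
  qed
qed

lemma norm_smoothed_term_le:
  "norm (of_real (neumann_factor n * cos (real n * s) * cos (real m * s)) * smoothed_coeff n) \<le> norm (smoothed_coeff n)"
proof -
  have "\<bar>neumann_factor n * cos (real n * s) * cos (real m * s)\<bar> \<le> 1 * 1 * 1"
    unfolding abs_mult by (intro mult_mono) (auto simp: neumann_factor_def)
  then show ?thesis unfolding norm_mult norm_of_real by (intro mult_left_le_one_le) auto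
qed

text \<open>
  The factor \<open>cos (m s)\<close> is carried along for the computation of the moments; \<open>m = 0\<close> removes it.
\<close>
lemma uniform_limit_smoothed:
  "uniform_limit S (\<lambda>N s. \<Sum>n<N. of_real (neumann_factor n * cos (real n * s) * cos (real m * s)) * smoothed_coeff n)
      (\<lambda>s. smoothed_sum s * of_real (cos (real m * s))) sequentially"
proof -
  have "uniform_limit S (\<lambda>N s. \<Sum>n<N. of_real (neumann_factor n * cos (real n * s) * cos (real m * s)) * smoothed_coeff n)
      (\<lambda>s. \<Sum>n. of_real (neumann_factor n * cos (real n * s) * cos (real m * s)) * smoothed_coeff n) sequentially"
    by (rule Weierstrass_m_test[OF norm_smoothed_term_le summable_smoothed_coeff])
  also have "(\<lambda>s. \<Sum>n. of_real (neumann_factor n * cos (real n * s) * cos (real m * s)) * smoothed_coeff n)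
      = (\<lambda>s. smoothed_sum s * of_real (cos (real m * s)))"
  proof
    fix s
    have "summable (\<lambda>n. of_real (neumann_factor n * cos (real n * s)) * smoothed_coeff n)"
      using norm_smoothed_term_le[where m = 0] by (intro summable_comparison_test'[OF summable_smoothed_coeff]) simp
    from suminf_mult2[OF this, of "of_real (cos (real m * s))"]
    show "(\<Sum>n. of_real (neumann_factor n * cos (real n * s) * cos (real m * s)) * smoothed_coeff n)
      = smoothed_sum s * of_real (cos (real m * s))"
      by (simp add: smoothed_sum_def mult_ac)
  qed
  finally show ?thesis .
qed

lemma continuous_on_smoothed_sum: "continuous_on S smoothed_sum"
proof -
  have "continuous_on S (\<lambda>s. smoothed_sum s * of_real (cos (real 0 * s)))"
    by (rule uniform_limit_theorem[OF _ uniform_limit_smoothed]) (intro always_eventually allI continuous_intros, simp)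
  then show ?thesis by simp
qed

lemma smoothed_sum_moment:
  "((\<lambda>s. smoothed_sum s * of_real (cos (real m * s))) has_integral (of_real (pi / 2) * smoothed_coeff m)) {0..pi}"
proof -
  let ?f = "\<lambda>N s. \<Sum>n<N. of_real (neumann_factor n * cos (real n * s) * cos (real m * s)) * smoothed_coeff n"
  obtain I J where IJ: "\<And>N. (?f N has_integral I N) {0..pi}"
      "((\<lambda>s. smoothed_sum s * of_real (cos (real m * s))) has_integral J) {0..pi}" "I \<longlonglongrightarrow> J"
  proof (rule uniform_limit_integral[OF uniform_limit_smoothed[where S = "{0..pi}" and m = m]])
    show "continuous_on {0..pi} (?f N)" for N by (intro continuous_intros)
  qed (simp, rule that)
  have "I N = of_real (pi / 2) * smoothed_coeff m" if "N > m" for N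
  proof -
    have one: "((\<lambda>s. of_real (neumann_factor n * cos (real n * s) * cos (real m * s)) * smoothed_coeff n)
         has_integral (if n = m then of_real (pi / 2) * smoothed_coeff n else 0)) {0..pi}" for n
    proof -
      have "(\<lambda>s. cos (real n * s) * cos (real m * s)) integrable_on {0..pi}"
        by (intro integrable_continuous_real continuous_intros)
      then have "((\<lambda>s. cos (real n * s) * cos (real m * s)) has_integral (if n = m then pi / 2 / neumann_factor n else 0)) {0..pi}"
        by (simp only: integrable_integral integral_cos_mult_cos[symmetric])
      from has_integral_mult_left[OF has_integral_of_real[OF has_integral_mult_right[OF this, of "neumann_factor n"]], of "smoothed_coeff n"]
      show ?thesis by (auto simp: mult.assoc neumann_factor_def split: if_splits)
    qed
    have "(?f N has_integral (\<Sum>n<N. if n = m then of_real (pi / 2) * smoothed_coeff n else 0)) {0..pi}"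
      by (intro has_integral_sum one) auto
    from has_integral_unique[OF IJ(1) this] show ?thesis using that by simp
  qed
  then have "eventually (\<lambda>N. I N = of_real (pi / 2) * smoothed_coeff m) sequentially"
    by (rule eventually_mono[OF eventually_gt_at_top])
  then have "I \<longlonglongrightarrow> of_real (pi / 2) * smoothed_coeff m" by (rule tendsto_eventually)
  with IJ show ?thesis using LIMSEQ_unique by blast
qed

lemma partial_sum_eq_poisson: "partial_sum N s = poisson \<mu> (\<lambda>t. of_real (cos_kernel N (a * t) s))"
proof -
  have "partial_sum N s = (\<Sum>n\<le>N. poisson \<mu> (\<lambda>t. of_real (neumann_factor n * cos (real n * s)) * of_real (cos (real n * (a * t)))))"
    by (simp only: partial_sum_def bessel_coeff_def poisson_mult_left)
  also have "\<dots> = poisson \<mu> (\<lambda>t. \<Sum>n\<le>N. of_real (neumann_factor n * cos (real n * s)) * of_real (cos (real n * (a * t))))"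
    by (rule poisson_sum[OF \<mu>, symmetric]) (intro continuous_intros)
  also have "\<dots> = poisson \<mu> (\<lambda>t. of_real (cos_kernel N (a * t) s))"
    by (rule poisson_cong) (simp add: cos_kernel_def mult_ac)
  finally show ?thesis .
qed

definition boundary_term :: "nat \<Rightarrow> real \<Rightarrow> complex" where
  "boundary_term N s = poisson \<mu> (\<lambda>t. of_real ((cos (a * t) - cos a) + (cos s - cos a))
      * of_real ((cos (real (Suc N) * (a * t)) * cos (real N * s) - cos (real N * (a * t)) * cos (real (Suc N) * s)) / 2))"

text \<open>
  Write \<open>d = cos s - cos a\<close>, \<open>D = cos (a t) - cos a\<close> and \<open>K\<close> for the kernel. Then
  \<open>d\<^sup>2 K = D\<^sup>2 K - (D + d) (D - d) K\<close>, where \<open>D - d = cos (a t) - cos s\<close>, so that \<open>(D - d) K\<close> telescopes.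
\<close>
lemma smoothed_partial_sum:
  "of_real ((cos s - cos a)\<^sup>2) * partial_sum N s
     = (\<Sum>n\<le>N. of_real (neumann_factor n * cos (real n * s)) * smoothed_coeff n) - boundary_term N s"
proof -
  have ck: "continuous_on {0..1} (\<lambda>t. cos_kernel N (a * t) s)"
    unfolding cos_kernel_def by (intro continuous_intros)
  have "of_real ((cos s - cos a)\<^sup>2) * partial_sum N s
     = poisson \<mu> (\<lambda>t. of_real ((cos s - cos a)\<^sup>2) * of_real (cos_kernel N (a * t) s))"
    by (simp only: partial_sum_eq_poisson poisson_mult_left)
  also have "\<dots> = poisson \<mu> (\<lambda>t. of_real ((cos (a * t) - cos a)\<^sup>2 * cos_kernel N (a * t) s)
       - of_real ((cos (a * t) - cos a) + (cos s - cos a))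
      * of_real ((cos (real (Suc N) * (a * t)) * cos (real N * s) - cos (real N * (a * t)) * cos (real (Suc N) * s)) / 2))"
  proof (rule poisson_cong)
    fix t
    have "(cos s - cos a)\<^sup>2 * cos_kernel N (a * t) s = (cos (a * t) - cos a)\<^sup>2 * cos_kernel N (a * t) s
        - ((cos (a * t) - cos a) + (cos s - cos a)) * ((cos (a * t) - cos s) * cos_kernel N (a * t) s)"
      by (simp add: algebra_simps power2_eq_square)
    then show "of_real ((cos s - cos a)\<^sup>2) * complex_of_real (cos_kernel N (a * t) s)
       = of_real ((cos (a * t) - cos a)\<^sup>2 * cos_kernel N (a * t) s)
       - of_real ((cos (a * t) - cos a) + (cos s - cos a))
      * of_real ((cos (real (Suc N) * (a * t)) * cos (real N * s) - cos (real N * (a * t)) * cos (real (Suc N) * s)) / 2)"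
      unfolding cos_kernel_christoffel_darboux by (simp only: of_real_mult[symmetric] of_real_diff[symmetric])
  qed
  also have "\<dots> = poisson \<mu> (\<lambda>t. of_real ((cos (a * t) - cos a)\<^sup>2 * cos_kernel N (a * t) s)) - boundary_term N s"
    unfolding boundary_term_def by (intro poisson_diff[OF \<mu>] continuous_intros ck) simp_all
  also have "poisson \<mu> (\<lambda>t. of_real ((cos (a * t) - cos a)\<^sup>2 * cos_kernel N (a * t) s))
    = poisson \<mu> (\<lambda>t. \<Sum>n\<le>N. of_real (neumann_factor n * cos (real n * s)) * of_real ((cos (a * t) - cos a)\<^sup>2 * cos (real n * (a * t))))"
    by (rule poisson_cong) (simp add: cos_kernel_def sum_distrib_left mult_ac)
  also have "\<dots> = (\<Sum>n\<le>N. of_real (neumann_factor n * cos (real n * s)) * smoothed_coeff n)"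
    unfolding smoothed_coeff_def poisson_mult_left[symmetric]
    by (rule poisson_sum[OF \<mu>]) (intro continuous_intros)
  finally show ?thesis .
qed

text \<open>
  The boundary term involves only coefficients with index \<open>N\<close> and \<open>N + 1\<close>, and these tend to \<open>0\<close> by the
  Riemann--Lebesgue lemma; the trigonometric factors in \<open>s\<close> are bounded, hence the uniformity.
\<close>
lemma uniform_limit_boundary_term: "uniform_limit S boundary_term (\<lambda>_. 0) sequentially"
proof -
  define M where "M = (\<lambda>n. poisson \<mu> (\<lambda>t. of_real ((cos (a * t) - cos a) * cos (real n * (a * t)))))"
  define q where "q = (\<lambda>n. norm (M n) + 2 * norm (bessel_coeff n))"
  have eq: "boundary_term N s = of_real (cos (real N * s) / 2) * (M (Suc N) + of_real (cos s - cos a) * bessel_coeff (Suc N))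
       - of_real (cos (real (Suc N) * s) / 2) * (M N + of_real (cos s - cos a) * bessel_coeff N)" for N s
  proof -
    let ?c = "\<lambda>n t. (of_real ((cos (a * t) - cos a) * cos (real n * (a * t))) + of_real (cos s - cos a) * of_real (cos (real n * (a * t))) :: complex)"
    have c: "continuous_on {0..1} (?c n)" for n by (intro continuous_intros)
    have "poisson \<mu> (?c n) = M n + of_real (cos s - cos a) * bessel_coeff n" for n
      unfolding M_def bessel_coeff_def poisson_mult_left[symmetric]
      by (rule poisson_add[OF \<mu>]) (intro continuous_intros)+
    note pc = this
    have "boundary_term N s = poisson \<mu> (\<lambda>t. of_real (cos (real N * s) / 2) * ?c (Suc N) t - of_real (cos (real (Suc N) * s) / 2) * ?c N t)"
      unfolding boundary_term_def
      by (rule poisson_cong) (simp add: field_simps del: of_nat_Suc)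
    also have "\<dots> = of_real (cos (real N * s) / 2) * poisson \<mu> (?c (Suc N)) - of_real (cos (real (Suc N) * s) / 2) * poisson \<mu> (?c N)"
      unfolding poisson_mult_left[symmetric]
      by (rule poisson_diff[OF \<mu>]) (intro continuous_on_mult_left c)+
    finally show ?thesis unfolding pc .
  qed
  have part: "norm (of_real (cos y / 2) * (M n + of_real (cos s - cos a) * bessel_coeff n)) \<le> q n" for n s y
  proof -
    have "\<bar>cos s - cos a\<bar> \<le> 2" using abs_cos_le_one[of s] abs_cos_le_one[of a] by linarith
    then have "norm (M n + of_real (cos s - cos a) * bessel_coeff n) \<le> q n"
      unfolding q_def by (intro norm_triangle_le add_mono) (auto simp only: norm_mult norm_of_real order_refl intro!: mult_right_mono norm_ge_zero)
    moreover have "\<bar>cos y / 2\<bar> \<le> 1" using abs_cos_le_one[of y] by linarith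
    ultimately have "\<bar>cos y / 2\<bar> * norm (M n + of_real (cos s - cos a) * bessel_coeff n) \<le> 1 * q n"
      by (intro mult_mono) auto
    then show ?thesis by (simp only: norm_mult norm_of_real mult_1)
  qed
  have bound: "norm (boundary_term N s) \<le> q (Suc N) + q N" for N s
    unfolding eq by (intro norm_triangle_le_diff add_mono part)
  have "q \<longlonglongrightarrow> norm (0::complex) + 2 * norm (0::complex)"
    unfolding q_def M_def by (intro tendsto_intros bessel_coeff_tendsto_0 bessel_coeff_cos_diff_tendsto_0)
  then have q0: "q \<longlonglongrightarrow> 0" by simp
  have lim: "(\<lambda>N. q (Suc N) + q N) \<longlonglongrightarrow> 0"
    using tendsto_add[OF LIMSEQ_Suc[OF q0] q0] by simp
  show ?thesis
  proof (rule uniform_limitI)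
    fix e :: real assume "e > 0"
    with order_tendstoD(2)[OF lim] have "eventually (\<lambda>N. q (Suc N) + q N < e) sequentially" by blast
    then show "\<forall>\<^sub>F N in sequentially. \<forall>s\<in>S. dist (boundary_term N s) 0 < e"
      by eventually_elim (auto intro: le_less_trans[OF bound])
  qed
qed

lemma uniform_limit_smoothed_partial_sum:
  "uniform_limit S (\<lambda>N s. of_real ((cos s - cos a)\<^sup>2) * partial_sum N s) smoothed_sum sequentially"
proof -
  have "uniform_limit S (\<lambda>N s. \<Sum>n<Suc N. of_real (neumann_factor n * cos (real n * s) * cos (real 0 * s)) * smoothed_coeff n)
      (\<lambda>s. smoothed_sum s * of_real (cos (real 0 * s))) sequentially"
    by (rule filterlim_compose[OF uniform_limit_smoothed filterlim_Suc])
  then have "uniform_limit S (\<lambda>N s. \<Sum>n\<le>N. of_real (neumann_factor n * cos (real n * s)) * smoothed_coeff n)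
      smoothed_sum sequentially"
    by (simp add: lessThan_Suc_atMost)
  from uniform_limit_minus[OF this uniform_limit_boundary_term]
  show ?thesis by (simp only: smoothed_partial_sum diff_0_right)
qed

text \<open>
  Both sides, the right one extended by \<open>0\<close> to \<open>[a, \<pi>]\<close>, are continuous and have the same cosine moments.
\<close>
lemma smoothed_sum_eq:
  assumes s: "s \<in> {0..a}"
  shows "smoothed_sum s = of_real (sqrt pi) / (of_real a * Gamma (\<mu> + 1/2)) * (of_real ((cos s - cos a)\<^sup>2) * weight (\<mu> - 1/2) (s / a))"
proof -
  define G where "G = (\<lambda>t. weight (\<mu> - 1/2) t * of_real ((cos (a * t) - cos a)\<^sup>2))"
  \<comment> \<open>The orthogonality constant \<open>\<pi>/2\<close>, the factor \<open>1/a\<close> of the substitution \<open>s = a t\<close>, and the normalisation of \<open>poisson\<close>.\<close>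
  define \<kappa> where "\<kappa> = of_real (sqrt pi) / (of_real a * Gamma (\<mu> + 1/2))"
  \<comment> \<open>The minimum encodes the extension by \<open>0\<close>, as \<open>G 1 = 0\<close>.\<close>
  define h where "h = (\<lambda>s. G (min (s / a) 1))"
  have G: "continuous_on {0..1} G"
    unfolding G_def using weight_cos_diff_decay[of "\<mu> - 1/2" a] \<mu> by auto
  have h: "continuous_on {0..pi} h"
    unfolding h_def using a by (intro continuous_on_compose2[OF G] continuous_intros) auto
  have Gam: "Gamma (\<mu> + 1/2) \<noteq> 0"
    using \<mu> by (auto simp: Gamma_eq_zero_iff intro!: not_nonpos_Int_if_Re_pos)
  have "smoothed_sum s - \<kappa> * h s = 0"
  proof (rule cosine_moments_zero_imp_zero)
    show "continuous_on {0..pi} (\<lambda>s. smoothed_sum s - \<kappa> * h s)"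
      by (intro continuous_intros continuous_on_smoothed_sum h)
    show "s \<in> {0..pi}" using s a by auto
    fix m :: nat
    let ?I = "integral {0..1} (\<lambda>t. G t * of_real (cos (real m * (a * t))))"
    have "((\<lambda>t. G t * of_real (cos (real m * (a * t)))) has_integral ?I) (cbox 0 1)"
      unfolding cbox_interval by (intro integrable_integral integrable_continuous_real continuous_intros G)
    from has_integral_affinity'[OF this, of "1/a" 0] a
    have "((\<lambda>s. G (s / a) * of_real (cos (real m * s))) has_integral of_real a * ?I) {0..a}"
      by (simp add: scaleR_conv_of_real)
    then have "((\<lambda>s. h s * of_real (cos (real m * s))) has_integral of_real a * ?I) {0..a}"
      by (rule has_integral_eq[rotated]) (use a in \<open>auto simp: h_def min_def field_simps\<close>)
    moreover have "((\<lambda>s. h s * of_real (cos (real m * s))) has_integral 0) {a..pi}"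
    proof (rule has_integral_is_0)
      fix s assume "s \<in> {a..pi}"
      then have "min (s / a) 1 = 1" using a by (auto simp: min_def field_simps)
      then show "h s * of_real (cos (real m * s)) = 0" by (simp add: h_def G_def)
    qed
    ultimately have hI: "((\<lambda>s. h s * of_real (cos (real m * s))) has_integral (of_real a * ?I + 0)) {0..pi}"
      by (rule has_integral_combine[rotated 2]) (use a in auto)
    have "((\<lambda>s. smoothed_sum s * of_real (cos (real m * s)) - \<kappa> * (h s * of_real (cos (real m * s))))
       has_integral (of_real (pi / 2) * smoothed_coeff m - \<kappa> * (of_real a * ?I + 0))) {0..pi}"
      by (intro has_integral_diff smoothed_sum_moment has_integral_mult_right hI)
    also have "of_real (pi / 2) * smoothed_coeff m - \<kappa> * (of_real a * ?I + 0) = 0"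
    proof -
      have I: "smoothed_coeff m = 2 / (of_real (sqrt pi) * Gamma (\<mu> + 1/2)) * ?I"
        unfolding smoothed_coeff_def poisson_def G_def by (simp add: mult.assoc)
      have "p / 2 * (2 / (q * g) * I) - q / (r * g) * (r * I + 0) = 0" if "q * q = p" "q \<noteq> 0" "g \<noteq> 0" "r \<noteq> 0" for p q g r I :: complex
        using that by (auto simp: field_simps)
      from this[of "of_real (sqrt pi)" "of_real pi" "Gamma (\<mu> + 1/2)" "of_real a" ?I] show ?thesis
        unfolding I \<kappa>_def using a Gam by (simp flip: of_real_mult)
    qed
    finally show "integral {0..pi} (\<lambda>s. (smoothed_sum s - \<kappa> * h s) * of_real (cos (real m * s))) = 0"
      by (simp add: integral_unique left_diff_distrib mult.assoc)
  qed
  moreover have "h s = of_real ((cos s - cos a)\<^sup>2) * weight (\<mu> - 1/2) (s / a)"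
    using s a by (simp add: h_def G_def min_def mult.commute)
  ultimately show ?thesis by (simp add: \<kappa>_def)
qed

text \<open>
  On \<open>[0, b]\<close> the factor \<open>(cos s - cos a)\<^sup>2\<close> is at least \<open>(cos b - cos a)\<^sup>2 > 0\<close> and can be divided out.
\<close>
lemma uniform_limit_partial_sum:
  assumes b: "0 \<le> b" "b < a"
  shows "uniform_limit {0..b} partial_sum
     (\<lambda>s. of_real (sqrt pi) / (of_real a * Gamma (\<mu> + 1/2)) * weight (\<mu> - 1/2) (s / a)) sequentially"
proof (rule uniform_limitI)
  let ?P = "\<lambda>s. of_real (sqrt pi) / (of_real a * Gamma (\<mu> + 1/2)) * weight (\<mu> - 1/2) (s / a)"
  fix e :: real assume e: "e > 0"
  define d where "d = (cos b - cos a)\<^sup>2"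
  have ba: "cos b - cos a > 0" using cos_monotone_0_pi[of b a] a b by simp
  then have d: "d > 0" by (simp add: d_def)
  have "uniform_limit {0..b} (\<lambda>N s. of_real ((cos s - cos a)\<^sup>2) * partial_sum N s) smoothed_sum sequentially"
    by (rule uniform_limit_smoothed_partial_sum)
  from uniform_limitD[OF this, of "d * e"] d e
  have "\<forall>\<^sub>F N in sequentially. \<forall>s\<in>{0..b}. dist (of_real ((cos s - cos a)\<^sup>2) * partial_sum N s) (smoothed_sum s) < d * e"
    by simp
  then show "\<forall>\<^sub>F N in sequentially. \<forall>s\<in>{0..b}. dist (partial_sum N s) (?P s) < e"
  proof eventually_elim
    case (elim N)
    show ?case
    proof
      fix s assume s: "s \<in> {0..b}"
      have "cos b \<le> cos s" using s a b by (intro cos_monotone_0_pi_le) auto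
      then have ds: "d \<le> (cos s - cos a)\<^sup>2" unfolding d_def using ba by (intro power_mono) auto
      have "smoothed_sum s = of_real ((cos s - cos a)\<^sup>2) * ?P s"
        using smoothed_sum_eq[of s] s b by simp
      then have eq: "of_real ((cos s - cos a)\<^sup>2) * partial_sum N s - smoothed_sum s = of_real ((cos s - cos a)\<^sup>2) * (partial_sum N s - ?P s)"
        by (simp only: right_diff_distrib)
      have "(cos s - cos a)\<^sup>2 * norm (partial_sum N s - ?P s) < d * e"
        using bspec[OF elim s] unfolding dist_norm eq norm_mult norm_of_real by (simp only: abs_power2)
      then have "d * norm (partial_sum N s - ?P s) < d * e"
        using mult_right_mono[OF ds, of "norm (partial_sum N s - ?P s)"] by simp
      then show "dist (partial_sum N s) (?P s) < e" using d by (simp add: dist_norm)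
    qed
  qed
qed

end

section \<open>The case k = 0\<close>

lemma binomial_series_weight:
  fixes c t :: real
  assumes c: "0 \<le> c" "c < 1" and t: "t \<in> {0..1}"
  shows "weight m (c * t) = (\<Sum>j. pochhammer (- m) j / fact j * of_real ((c\<^sup>2) ^ j) * of_real (t ^ (2 * j)))"
proof -
  have "c * t < 1" using c t by (metis atLeastAtMost_iff mult_left_le order_le_less_trans)
  then have "(c * t)\<^sup>2 < 1" using c t by (simp add: abs_square_less_1)
  then have "norm (- complex_of_real ((c * t)\<^sup>2)) < 1" by (simp only: norm_minus_cancel norm_of_real abs_power2)
  from gen_binomial_complex[OF this, of m]
  have "(\<lambda>j. (m gchoose j) * (- of_real ((c * t)\<^sup>2)) ^ j) sums weight m (c * t)"
    by (simp add: weight_def)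
  moreover have "(m gchoose j) * (- of_real ((c * t)\<^sup>2)) ^ j = pochhammer (- m) j / fact j * of_real ((c\<^sup>2) ^ j) * of_real (t ^ (2 * j))" for j
  proof -
    have "(- complex_of_real ((c * t)\<^sup>2)) ^ j = (-1) ^ j * (of_real ((c\<^sup>2) ^ j) * of_real (t ^ (2 * j)))"
      by (subst power_minus) (simp add: power_mult_distrib power_mult)
    then show ?thesis by (simp add: gbinomial_pochhammer flip: power_add power_mult_distrib)
  qed
  ultimately show ?thesis by (simp add: sums_iff)
qed

text \<open>
  Inside the disc of convergence a power series converges absolutely: compare at \<open>x\<close> and at a point
  between \<open>x\<close> and \<open>1\<close>.
\<close>
lemma summable_binomial_coeffs:
  fixes x :: real
  assumes x: "0 \<le> x" "x < 1"
  shows "summable (\<lambda>j. norm (pochhammer (- m) j / fact j * of_real (x ^ j) :: complex))"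
proof -
  define y where "y = (x + 1) / 2"
  have y: "x < y" "y < 1" "0 < y" using x by (auto simp: y_def)
  have "summable (\<lambda>j. (m gchoose j) * complex_of_real y ^ j)"
    using gen_binomial_complex[of "of_real y" m] y by (auto simp: sums_iff)
  from powser_insidea[OF this, of "of_real x"] x y
  show ?thesis by (simp add: gbinomial_pochhammer norm_mult norm_divide norm_power)
qed

text \<open>
  The case \<open>k = 0\<close>. Each \<open>J\<^sub>\<nu>(b n) (b n / 2)\<^sup>-\<^sup>\<nu>\<close> is \<open>poisson \<nu>\<close> of \<open>cos (b n t)\<close>, so a partial sum is \<open>poisson \<nu>\<close> of a
  partial sum of the cosine series, evaluated at \<open>b t\<close>. Uniform convergence passes to the limit under
  \<open>poisson \<nu>\<close>, and the binomial series of the limit function gives the hypergeometric terms.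
\<close>
lemma Bessel_sum_and_hypergeo_sum_agree_0:
  fixes a b :: real and \<mu> \<nu> :: complex
  assumes ab: "0 < b" "b < a" "a < pi" and \<mu>: "Re \<mu> > -1/2" and \<nu>: "Re \<nu> > -1/2"
  obtains V where
    "(\<lambda>n. of_real (neumann_factor n) * Bessel_J_quot \<mu> (of_real (a * real n)) * Bessel_J_quot \<nu> (of_real (b * real n))) sums V"
    "(\<lambda>j. Gamma (1/2) / (of_real a * Gamma (\<nu> + 1) * Gamma (\<mu> + 1/2)) *
       (pochhammer (1/2) j * pochhammer (1/2 - \<mu>) j / pochhammer (\<nu> + 1) j * (of_real ((b/a)\<^sup>2) ^ j / fact j))) sums V"
proof -
  interpret cosine_series a \<mu>
    by unfold_locales (use assms in auto)
  define \<kappa> where "\<kappa> = of_real (sqrt pi) / (of_real a * Gamma (\<mu> + 1/2))"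
  define V where "V = poisson \<nu> (\<lambda>t. \<kappa> * weight (\<mu> - 1/2) (b / a * t))"
  have "uniform_limit {0..1} (\<lambda>N t. partial_sum N (b * t)) (\<lambda>t. \<kappa> * weight (\<mu> - 1/2) (b * t / a)) sequentially"
  proof (rule uniform_limitI)
    fix e :: real assume "e > 0"
    from uniform_limitD[OF uniform_limit_partial_sum[of b] this] ab
    have "\<forall>\<^sub>F N in sequentially. \<forall>s\<in>{0..b}. dist (partial_sum N s) (\<kappa> * weight (\<mu> - 1/2) (s / a)) < e"
      by (simp only: \<kappa>_def less_imp_le)
    then show "\<forall>\<^sub>F N in sequentially. \<forall>t\<in>{0..1}. dist (partial_sum N (b * t)) (\<kappa> * weight (\<mu> - 1/2) (b * t / a)) < e"
    proof eventually_elim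
      case (elim N)
      have "b * t \<in> {0..b}" if "t \<in> {0..1}" for t
        using that ab mult_left_le[of t b] by auto
      then show ?case using elim by blast
    qed
  qed
  from poisson_uniform_limit[OF \<nu> this]
  have "(\<lambda>N. poisson \<nu> (\<lambda>t. partial_sum N (b * t))) \<longlonglongrightarrow> V"
    unfolding V_def partial_sum_def by (simp add: continuous_intros)
  moreover have "poisson \<nu> (\<lambda>t. partial_sum N (b * t))
     = (\<Sum>n\<le>N. of_real (neumann_factor n) * Bessel_J_quot \<mu> (of_real (a * real n)) * Bessel_J_quot \<nu> (of_real (b * real n)))" for N
  proof -
    have "poisson \<nu> (\<lambda>t. partial_sum N (b * t)) = (\<Sum>n\<le>N. poisson \<nu> (\<lambda>t. (of_real (neumann_factor n) * bessel_coeff n) * of_real (cos (b * real n * t))))"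
      unfolding partial_sum_def
      by (subst poisson_sum[OF \<nu>, symmetric]) (auto intro!: continuous_intros poisson_cong sum.cong simp: mult_ac)
    also have "\<dots> = (\<Sum>n\<le>N. of_real (neumann_factor n) * Bessel_J_quot \<mu> (of_real (a * real n)) * Bessel_J_quot \<nu> (of_real (b * real n)))"
    proof -
      have "Bessel_J_quot \<mu> (of_real (a * real n)) = bessel_coeff n" for n
        unfolding bessel_coeff_def by (subst Bessel_J_quot_eq_poisson[OF \<mu>]) (use ab in \<open>auto simp: mult_ac\<close>)
      moreover have "Bessel_J_quot \<nu> (of_real (b * real n)) = poisson \<nu> (\<lambda>t. of_real (cos (b * real n * t)))" for n
        using ab by (intro Bessel_J_quot_eq_poisson[OF \<nu>]) simp
      ultimately show ?thesis by (simp only: poisson_mult_left)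
    qed
    finally show ?thesis .
  qed
  ultimately have 1: "(\<lambda>n. of_real (neumann_factor n) * Bessel_J_quot \<mu> (of_real (a * real n)) * Bessel_J_quot \<nu> (of_real (b * real n))) sums V"
    unfolding sums_def_le by simp
  have c: "0 \<le> b / a" "b / a < 1" using ab by auto
  let ?a = "\<lambda>j. pochhammer (- (\<mu> - 1/2)) j / fact j * of_real (((b / a)\<^sup>2) ^ j)"
  have Vs: "V = \<kappa> * poisson \<nu> (\<lambda>t. \<Sum>j. ?a j * of_real (t ^ (2 * j)))"
    unfolding V_def poisson_mult_left by (intro arg_cong2[of _ _ _ _ "(*)"] refl poisson_cong binomial_series_weight c)
  have "summable (\<lambda>j. norm (?a j))"
    by (rule summable_binomial_coeffs) (use c in \<open>auto simp: abs_square_less_1\<close>)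
  then have "(\<lambda>j. \<kappa> * (?a j * (pochhammer (1/2) j / Gamma (\<nu> + 1 + of_nat j)))) sums V"
    unfolding Vs by (intro sums_mult poisson_power_series[OF \<nu>])
  moreover have "\<kappa> * (?a j * (pochhammer (1/2) j / Gamma (\<nu> + 1 + of_nat j)))
     = Gamma (1/2) / (of_real a * Gamma (\<nu> + 1) * Gamma (\<mu> + 1/2)) *
       (pochhammer (1/2) j * pochhammer (1/2 - \<mu>) j / pochhammer (\<nu> + 1) j * (of_real ((b/a)\<^sup>2) ^ j / fact j))" for j
  proof -
    have "\<nu> + 1 \<notin> \<int>\<^sub>\<le>\<^sub>0" using \<nu> by (intro not_nonpos_Int_if_Re_pos) simp
    then have "Gamma (\<nu> + 1 + of_nat j) = Gamma (\<nu> + 1) * pochhammer (\<nu> + 1) j"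
      by (simp add: pochhammer_Gamma Gamma_eq_zero_iff)
    moreover have "s / (A * M) * (p / f * x * (h / (N * q))) = s / (A * N * M) * (h * p / q * (x / f))" for s A M p f x h N q :: complex
      by (simp add: divide_inverse mult_ac)
    ultimately show ?thesis
      by (simp add: \<kappa>_def Gamma_one_half_complex del: times_divide_eq_left times_divide_eq_right)
  qed
  ultimately have "(\<lambda>j. Gamma (1/2) / (of_real a * Gamma (\<nu> + 1) * Gamma (\<mu> + 1/2)) *
       (pochhammer (1/2) j * pochhammer (1/2 - \<mu>) j / pochhammer (\<nu> + 1) j * (of_real ((b/a)\<^sup>2) ^ j / fact j))) sums V"
    by (simp only:)
  with 1 show thesis by (rule that)
qed

section \<open>Recurrences and induction on k\<close>

text \<open>
  The three-term recurrence \<open>J\<^bsub>\<nu>\<^esub> + J\<^bsub>\<nu>+2\<^esub> = (2 (\<nu> + 1) / x) J\<^bsub>\<nu>+1\<^esub>\<close>, compared coefficientwise; in terms of the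
  quotients it trades a factor \<open>(x/2)\<^sup>2\<close> for a lower order.
\<close>
lemma Bessel_J_quot_recurrence:
  assumes \<nu>: "Re \<nu> > -1/2" and x: "x \<ge> 0"
  shows "of_real (x / 2) ^ 2 * Bessel_J_quot (\<nu> + 2) (of_real x)
           = (\<nu> + 1) * Bessel_J_quot (\<nu> + 1) (of_real x) - Bessel_J_quot \<nu> (of_real x)"
proof -
  define y where "y = complex_of_real (x / 2)"
  define f where "f = (\<lambda>\<nu> n. (-1) ^ n / (Gamma (\<nu> + of_nat n + 1) * fact n) * y ^ (2 * n))"
  have f: "f \<nu> sums Bessel_J_quot \<nu> (of_real x)" if "Re \<nu> > -1/2" for \<nu>
    unfolding f_def y_def using poisson_cos_sums[OF that] Bessel_J_quot_eq_poisson[OF that x] by simp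
  let ?g = "\<lambda>n. (\<nu> + 1) * f (\<nu> + 1) n - f \<nu> n"
  have Gam: "Gamma (\<nu> + of_nat n + 2) = (\<nu> + of_nat n + 1) * Gamma (\<nu> + of_nat n + 1)"
       "Gamma (\<nu> + of_nat n + 1) \<noteq> 0" "\<nu> + of_nat n + 1 \<noteq> 0" for n
  proof -
    have "\<nu> + of_nat n + 1 \<notin> \<int>\<^sub>\<le>\<^sub>0" using \<nu> by (intro not_nonpos_Int_if_Re_pos) simp
    then show "Gamma (\<nu> + of_nat n + 2) = (\<nu> + of_nat n + 1) * Gamma (\<nu> + of_nat n + 1)"
      "Gamma (\<nu> + of_nat n + 1) \<noteq> 0" "\<nu> + of_nat n + 1 \<noteq> 0"
      using Gamma_plus1[of "\<nu> + of_nat n + 1"] by (auto simp: Gamma_eq_zero_iff add_ac)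
  qed
  have g: "?g n = - of_nat n * (-1) ^ n / (Gamma (\<nu> + of_nat n + 2) * fact n) * y ^ (2 * n)" for n
  proof -
    have "f (\<nu> + 1) n = (-1) ^ n / (Gamma (\<nu> + of_nat n + 2) * fact n) * y ^ (2 * n)"
      unfolding f_def by (simp add: add_ac)
    moreover have "m * (s / ((z * G) * c) * w) - s / (G * c) * w = (m - z) * s / (z * G * c) * w"
      if "z \<noteq> 0" "G \<noteq> 0" "c \<noteq> 0" for m s z G c w :: complex
      using that by (simp add: field_simps)
    from this[OF Gam(3)[of n] Gam(2)[of n], of "fact n" "\<nu> + 1" "(-1) ^ n" "y ^ (2 * n)"]
    have "(\<nu> + 1) * ((-1) ^ n / (Gamma (\<nu> + of_nat n + 2) * fact n) * y ^ (2 * n)) - f \<nu> n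
        = - of_nat n * (-1) ^ n / (Gamma (\<nu> + of_nat n + 2) * fact n) * y ^ (2 * n)"
      unfolding f_def Gam(1) by simp
    ultimately show ?thesis by simp
  qed
  have "?g (Suc n) = y ^ 2 * f (\<nu> + 2) n" for n
  proof -
    have "?g (Suc n) = - of_nat (Suc n) * (-1) ^ Suc n / (Gamma (\<nu> + of_nat (Suc n) + 2) * fact (Suc n)) * y ^ (2 * Suc n)"
      by (rule g)
    also have "\<dots> = (-1) ^ n / (Gamma (\<nu> + of_nat (Suc n) + 2) * fact n) * y ^ (2 * Suc n)"
    proof -
      have "- S * (- u) / (G * (S * c)) * w = u / (G * c) * w" if "S \<noteq> 0" for S u G c w :: complex
        using that by simp
      from this[of "of_nat (Suc n)"] show ?thesis
        by (simp only: fact_Suc power_Suc mult_minus1 of_nat_neq_0 not_False_eq_True)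
    qed
    also have "\<dots> = y ^ 2 * f (\<nu> + 2) n"
      by (simp add: f_def add_ac power2_eq_square)
    finally show ?thesis .
  qed
  moreover have "(\<lambda>n. y ^ 2 * f (\<nu> + 2) n) sums (y ^ 2 * Bessel_J_quot (\<nu> + 2) (of_real x))"
    using \<nu> by (intro sums_mult f) simp
  ultimately have "(\<lambda>n. ?g (Suc n)) sums (y ^ 2 * Bessel_J_quot (\<nu> + 2) (of_real x))" by simp
  moreover have "?g 0 = 0" unfolding g by simp
  ultimately have "?g sums (y ^ 2 * Bessel_J_quot (\<nu> + 2) (of_real x))"
    by (subst (asm) sums_Suc_iff) simp
  moreover have "?g sums ((\<nu> + 1) * Bessel_J_quot (\<nu> + 1) (of_real x) - Bessel_J_quot \<nu> (of_real x))"
    using \<nu> by (intro sums_diff sums_mult f) simp_all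
  ultimately show ?thesis unfolding y_def by (rule sums_unique2)
qed

text \<open>
  The terms of the hypergeometric series with the prefactor of the theorem included, because the
  contiguous relation below then has the coefficients of the Bessel recurrence.
\<close>
definition hypergeo_term :: "real \<Rightarrow> real \<Rightarrow> complex \<Rightarrow> nat \<Rightarrow> complex \<Rightarrow> nat \<Rightarrow> complex" where
  "hypergeo_term a b \<nu> k \<mu> j =
     Gamma (of_nat k + 1/2) / (of_real a * Gamma (\<nu> + 1) * Gamma (\<mu> - of_nat k + 1/2)) *
       (pochhammer (1/2 + of_nat k) j * pochhammer (1/2 - \<mu> + of_nat k) j / pochhammer (\<nu> + 1) j
          * (of_real ((b/a)\<^sup>2) ^ j / fact j))"

text \<open>
  With \<open>\<alpha> = k + 1/2\<close> and \<open>\<beta> = k - 1/2 - \<mu>\<close> this is the contiguous relation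
  \<open>\<alpha> F(\<alpha> + 1, \<beta>) = (\<alpha> - \<beta>) F(\<alpha>, \<beta>) + \<beta> F(\<alpha>, \<beta> + 1)\<close>, which holds term by term since
  \<open>\<alpha> + j = (\<alpha> - \<beta>) + (\<beta> + j)\<close>.
\<close>
lemma hypergeo_term_recurrence:
  assumes \<mu>: "Re \<mu> > 2 * real k - 1/2"
  shows "hypergeo_term a b \<nu> (Suc k) (\<mu> + 2) j = (\<mu> + 1) * hypergeo_term a b \<nu> k (\<mu> + 1) j - hypergeo_term a b \<nu> k \<mu> j"
proof -
  define \<alpha> where "\<alpha> = 1/2 + (of_nat k :: complex)"
  define \<beta> where "\<beta> = 1/2 - (\<mu> + 1) + of_nat k"
  define G where "G = Gamma (\<mu> - of_nat k + 1/2)"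
  have pos: "\<mu> - of_nat k + 1/2 \<notin> \<int>\<^sub>\<le>\<^sub>0" "\<alpha> \<notin> \<int>\<^sub>\<le>\<^sub>0"
    using \<mu> by (auto intro!: not_nonpos_Int_if_Re_pos simp: \<alpha>_def)
  have \<beta>: "\<beta> \<noteq> 0" using \<mu> by (auto simp: \<beta>_def complex_eq_iff)
  have G0: "G \<noteq> 0" using pos by (simp add: G_def Gamma_eq_zero_iff)
  have G1: "Gamma (\<mu> + 1 - of_nat k + 1/2) = - \<beta> * G" 
    using Gamma_plus1[OF pos(1)] by (simp add: \<beta>_def G_def algebra_simps)
  have G2: "Gamma (\<mu> + 2 - of_nat (Suc k) + 1/2) = - \<beta> * G" 
    using Gamma_plus1[OF pos(1)] by (simp add: \<beta>_def G_def algebra_simps)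
  have A: "Gamma (of_nat (Suc k) + 1/2) = \<alpha> * Gamma \<alpha>"
    using Gamma_plus1[OF pos(2)] by (simp add: \<alpha>_def algebra_simps)
  have args: "1/2 + of_nat (Suc k) = \<alpha> + 1" "1/2 - (\<mu> + 2) + of_nat (Suc k) = \<beta>" 
      "1/2 + of_nat k = \<alpha>" "of_nat k + 1/2 = \<alpha>" "1/2 - \<mu> + of_nat k = \<beta> + 1" "1/2 - (\<mu> + 1) + of_nat k = \<beta>"
    by (simp_all add: \<alpha>_def \<beta>_def)
  have pa: "\<alpha> * pochhammer (\<alpha> + 1) j = (\<alpha> + of_nat j) * pochhammer \<alpha> j"
    and pb: "\<beta> * pochhammer (\<beta> + 1) j = (\<beta> + of_nat j) * pochhammer \<beta> j"
    using pochhammer_rec[of \<alpha> j] pochhammer_rec'[of \<alpha> j] pochhammer_rec[of \<beta> j] pochhammer_rec'[of \<beta> j] by simp_all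
  have \<mu>1: "\<mu> + 1 = \<alpha> - \<beta>" by (simp add: \<alpha>_def \<beta>_def)
  define A0 where "A0 = Gamma \<alpha>"
  define N where "N = of_real a * Gamma (\<nu> + 1)"
  define pA where "pA = pochhammer \<alpha> j" 
  define pA1 where "pA1 = pochhammer (\<alpha> + 1) j"
  define pB where "pB = pochhammer \<beta> j"
  define pB1 where "pB1 = pochhammer (\<beta> + 1) j"
  define q where "q = inverse (pochhammer (\<nu> + 1) j) * (of_real ((b/a)\<^sup>2) ^ j / fact j)"
  have "hypergeo_term a b \<nu> (Suc k) (\<mu> + 2) j = (\<alpha> * pA1) * pB * (A0 * q / (N * (- \<beta> * G)))"
    unfolding hypergeo_term_def args A G2 A0_def N_def pA1_def pB_def q_def by (simp add: divide_inverse mult_ac)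
  also have "\<dots> = ((\<alpha> - \<beta>) * (pA * pB) + pA * (\<beta> * pB1)) * (A0 * q / (N * (- \<beta> * G)))"
    using pa pb by (simp only: pA_def pA1_def pB_def pB1_def) (simp add: algebra_simps)
  also have "\<dots> = (\<mu> + 1) * (pA * pB * (A0 * q / (N * (- \<beta> * G)))) + pA * pB1 * (\<beta> * (A0 * q / (N * (- \<beta> * G))))"
    unfolding \<mu>1 by (simp only: distrib_right mult.assoc mult.left_commute)
  finally have eq: "hypergeo_term a b \<nu> (Suc k) (\<mu> + 2) j
      = (\<mu> + 1) * (pA * pB * (A0 * q / (N * (- \<beta> * G)))) + pA * pB1 * (\<beta> * (A0 * q / (N * (- \<beta> * G))))" .
  have "\<beta> * (A0 * q / (N * (- \<beta> * G))) = - (A0 * q / (N * G))"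
    using \<beta> by simp
  moreover have "pA * pB * (A0 * q / (N * (- \<beta> * G))) = hypergeo_term a b \<nu> k (\<mu> + 1) j"
    unfolding hypergeo_term_def args G1 A0_def N_def pA_def pB_def q_def by (simp add: divide_inverse mult_ac)
  moreover have "pA * pB1 * (A0 * q / (N * G)) = hypergeo_term a b \<nu> k \<mu> j"
    unfolding hypergeo_term_def args A0_def N_def pA_def pB1_def q_def G_def[symmetric] by (simp add: divide_inverse mult_ac)
  ultimately show ?thesis unfolding eq by (simp only: mult_minus_right add_uminus_conv_diff)
qed

text \<open>
  Induction on \<open>k\<close>: both series satisfy the same recurrence, which lowers \<open>k\<close> by \<open>1\<close> and \<open>\<mu>\<close> by \<open>1\<close> or \<open>2\<close>, within
  the range \<open>Re \<mu> > 2k - 1/2\<close>. Stating that both series converge to a common value \<open>V\<close> also yields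
  the convergence of the hypergeometric series along the way.
\<close>
lemma Bessel_sum_and_hypergeo_sum_agree:
  fixes a b :: real and \<mu> \<nu> :: complex
  assumes ab: "0 < b" "b < a" "a < pi" and \<nu>: "Re \<nu> > -1/2" and \<mu>: "Re \<mu> > 2 * real k - 1/2"
  shows "\<exists>V. (\<lambda>n. of_real (neumann_factor n) * Bessel_J_quot \<mu> (of_real (a * real n))
            * Bessel_J_quot \<nu> (of_real (b * real n)) * of_real (a * real n / 2) ^ (2 * k)) sums V
          \<and> hypergeo_term a b \<nu> k \<mu> sums V"
  using \<mu>
proof (induction k arbitrary: \<mu>)
  case 0
  then have "Re \<mu> > -1/2" by simp
  from Bessel_sum_and_hypergeo_sum_agree_0[OF ab this \<nu>]
  show ?case by (simp add: hypergeo_term_def[abs_def]) blast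
next
  case (Suc k \<mu>')
  define \<mu> where "\<mu> = \<mu>' - 2"
  have \<mu>': "\<mu>' = \<mu> + 2" and \<mu>: "Re \<mu> > 2 * real k - 1/2" "Re (\<mu> + 1) > 2 * real k - 1/2" "Re \<mu> > -1/2"
    using Suc.prems by (simp_all add: \<mu>_def)
  let ?s = "\<lambda>k \<mu> n. of_real (neumann_factor n) * Bessel_J_quot \<mu> (of_real (a * real n))
            * Bessel_J_quot \<nu> (of_real (b * real n)) * of_real (a * real n / 2) ^ (2 * k)"
  obtain V where V: "?s k \<mu> sums V" "hypergeo_term a b \<nu> k \<mu> sums V"
    using Suc.IH[OF \<mu>(1)] by blast
  obtain W where W: "?s k (\<mu> + 1) sums W" "hypergeo_term a b \<nu> k (\<mu> + 1) sums W"
    using Suc.IH[OF \<mu>(2)] by blast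
  have "?s (Suc k) \<mu>' n = (\<mu> + 1) * ?s k (\<mu> + 1) n - ?s k \<mu> n" for n
  proof -
    have "a * real n \<ge> 0" using ab by simp
    note rec = Bessel_J_quot_recurrence[OF \<mu>(3) this]
    have "?s (Suc k) \<mu>' n = of_real (neumann_factor n) * (of_real (a * real n / 2) ^ 2 * Bessel_J_quot (\<mu> + 2) (of_real (a * real n)))
            * Bessel_J_quot \<nu> (of_real (b * real n)) * of_real (a * real n / 2) ^ (2 * k)"
    proof -
      have "y ^ (2 * Suc k) = y ^ 2 * y ^ (2 * k)" for y :: complex
        by (simp add: power2_eq_square)
      then show ?thesis by (simp only: \<mu>' mult_ac)
    qed
    then show ?thesis unfolding rec by (simp only: right_diff_distrib left_diff_distrib mult_ac)
  qed
  then have "?s (Suc k) \<mu>' sums ((\<mu> + 1) * W - V)"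
    using sums_diff[OF sums_mult[OF W(1), of "\<mu> + 1"] V(1)] by (simp only:)
  moreover have "hypergeo_term a b \<nu> (Suc k) \<mu>' sums ((\<mu> + 1) * W - V)"
    using sums_diff[OF sums_mult[OF W(2), of "\<mu> + 1"] V(2)] unfolding \<mu>' hypergeo_term_recurrence[OF \<mu>(1), abs_def] .
  ultimately show ?case by blast
qed

theorem theorem1:
  fixes a b :: real and k :: nat and \<mu> \<nu> :: complex
  assumes "0 < b" and "b < a" and "a < pi"
    and "Re \<mu> > 2 * real k - 1 / 2" and "Re \<nu> > - 1 / 2"
  shows "(\<lambda>n::nat. (if n = 0 then 1 / 2 else 1)
            * Bessel_J_quot \<mu> (of_real (a * real n))
            * Bessel_J_quot \<nu> (of_real (b * real n))
            * of_real (a * real n / 2) ^ (2 * k))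
         sums
         (Gamma (of_nat k + 1 / 2)
            / (of_real a * Gamma (\<nu> + 1) * Gamma (\<mu> - of_nat k + 1 / 2))
            * hypergeo_2F1 (1 / 2 + of_nat k) (1 / 2 - \<mu> + of_nat k) (\<nu> + 1)
                (of_real ((b / a)\<^sup>2)))"
proof -
  let ?C = "Gamma (of_nat k + 1 / 2) / (of_real a * Gamma (\<nu> + 1) * Gamma (\<mu> - of_nat k + 1 / 2))"
  obtain V where V: "(\<lambda>n. of_real (neumann_factor n) * Bessel_J_quot \<mu> (of_real (a * real n))
            * Bessel_J_quot \<nu> (of_real (b * real n)) * of_real (a * real n / 2) ^ (2 * k)) sums V"
          "hypergeo_term a b \<nu> k \<mu> sums V"
    using Bessel_sum_and_hypergeo_sum_agree[OF assms(1-3,5,4)] by blast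
  have "(of_nat k + 1/2 :: complex) \<notin> \<int>\<^sub>\<le>\<^sub>0" "\<nu> + 1 \<notin> \<int>\<^sub>\<le>\<^sub>0" "\<mu> - of_nat k + 1/2 \<notin> \<int>\<^sub>\<le>\<^sub>0"
    using assms by (auto intro!: not_nonpos_Int_if_Re_pos)
  then have C: "?C \<noteq> 0" using assms by (simp add: Gamma_eq_zero_iff)
  have "V = ?C * hypergeo_2F1 (1/2 + of_nat k) (1/2 - \<mu> + of_nat k) (\<nu> + 1) (of_real ((b/a)\<^sup>2))"
  proof -
    have "V / ?C = hypergeo_2F1 (1/2 + of_nat k) (1/2 - \<mu> + of_nat k) (\<nu> + 1) (of_real ((b/a)\<^sup>2))"
      unfolding hypergeo_2F1_def
      using sums_mult_D[OF V(2)[unfolded hypergeo_term_def[abs_def]] C] by (rule sums_unique)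
    then show ?thesis using nonzero_mult_div_cancel_left[OF C, of V] by (metis times_divide_eq_right)
  qed
  moreover have "of_real (neumann_factor n) = (if n = 0 then 1 / 2 else 1 :: complex)" for n
    by (simp add: neumann_factor_def)
  ultimately show ?thesis using V(1) by (simp only:)
qed

end
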